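(* Let $H=(C,E)$ be any fixed connected graph, and let $q=|C|$. Put $s=4q+1$ and $\gamma=2q^s+1$. For any integer $n$ (the number of sites of the path) define the following $n+s\gamma-1$ blocks, constructed so that each site is contained in exactly $s\gamma$ blocks: $$\Theta_k=\begin{cases}\{k,\dots,\min(k+s\gamma-1,n)\} & \text{when }k\in\{1,\dots,n\},\\ \{1,\dots,n+s\gamma-k\} & \text{when }k\in\{n+1,\dots,n+s\gamma-1\}.\end{cases}$$ Let $\mathcal{M}_{\mathrm{RND}}$ be the random update Markov chain, on the state space $\Omega_\sim$, which at each step selects a block uniformly at random and performs a heat-bath move on it. The mixing time of $\mathcal{M}_{\mathrm{RND}}$, as a function of the deviation $\epsilon$ from stationarity, satisfies $$\mathrm{Mix}(\mathcal{M}_{\mathrm{RND}},\epsilon)\le\frac{(n+2sq^s+s-1)\log(n\epsilon^{-1})}{s}$$ block-updates. This corresponds to $O(n\log n)$ updates since the size of each block is at most $s\gamma=O(1)$.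
   Context: $H=(C,E)$ is a finite undirected graph, loops allowed; elements of $C$ are called colours. $\log$ is the natural logarithm. The $n$-vertex path has site set $V=\{1,\dots,n\}$ and edges $\{i,i+1\}$, $1\le i<n$. Blocks are sets of sites of the path, i.e. only their elements in $V$ count. An $H$-colouring of the path is a function $h:V\to C$ with $(h(i),h(i+1))\in E$ for all $1\le i<n$; $\Omega$ is the set of all $H$-colourings. The state space $\Omega_\sim$ is: $\Omega_\sim=\Omega$ if $H$ is not bipartite; if $H$ is bipartite with colour classes $C_1,C_2$, then $\Omega_\sim$ is one of $\Omega_1=\{x\in\Omega:x_1\in C_1\}$ and $\Omega_2=\{x\in\Omega:x_1\in C_2\}$. A configuration is any function $V\to C$. A heat-bath move on $\Lambda\subseteq V$ from a configuration $x$ draws a new configuration uniformly from $\Omega_\Lambda(x)$, the set of configurations that agree with $x$ on $V\setminus\Lambda$ and in which, for every edge of the path containing a site of $\Lambda$, the colours assigned to its endpoints are adjacent in $H$; the move is a transition within the state space $\Omega_\sim$. For a Markov chain $\mathcal{M}$ with state space $\Omega_\sim$, transition matrix $P$ and stationary distribution $\pi$ (here uniform on $\Omega_\sim$), $\mathrm{Mix}(\mathcal{M},\epsilon)=\max_{x\in\Omega_\sim}\min\{t>0: d_{\mathrm{TV}}(P^t(x,\cdot),\pi)\le\epsilon\}$, where $d_{\mathrm{TV}}(\theta_1,\theta_2)=\frac12\sum_i|\theta_1(i)-\theta_2(i)|$.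
   Formalization: Assumes n ≥ 1, ε > 0 and that either n ≥ 2 and ε < 1, or the stated bound is at least 1; otherwise the bound is below 1 while Mix ≥ 1 since t > 0 (e.g. one looped vertex, n = 1, ε = 0.9), so the claim fails. *)

theory Defs
  imports "HOL-Probability.Probability" "HOL-Library.Landau_Symbols"
begin

section \<open>Graphs and colourings of the path\<close>

text \<open>An undirected graph, possibly with loops, is a finite set of colours \<open>C\<close> together with a
  symmetric relation \<open>E\<close> on it.\<close>

definition graph :: "'c set \<Rightarrow> ('c \<times> 'c) set \<Rightarrow> bool" where
  "graph C E \<longleftrightarrow> finite C \<and> E \<subseteq> C \<times> C \<and> sym E"

definition connected_graph :: "'c set \<Rightarrow> ('c \<times> 'c) set \<Rightarrow> bool" where
  "connected_graph C E \<longleftrightarrow> graph C E \<and> C \<noteq> {} \<and> (\<forall>u\<in>C. \<forall>v\<in>C. (u, v) \<in> E\<^sup>*)"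

definition bipartition :: "'c set \<Rightarrow> ('c \<times> 'c) set \<Rightarrow> 'c set \<Rightarrow> 'c set \<Rightarrow> bool" where
  "bipartition C E C1 C2 \<longleftrightarrow>
     C1 \<union> C2 = C \<and> C1 \<inter> C2 = {} \<and> E \<subseteq> C1 \<times> C2 \<union> C2 \<times> C1"

definition bipartite :: "'c set \<Rightarrow> ('c \<times> 'c) set \<Rightarrow> bool" where
  "bipartite C E \<longleftrightarrow> (\<exists>C1 C2. bipartition C E C1 C2)"

text \<open>Configurations of the path with sites \<open>{1..n}\<close> are extensional functions, so that they are
  determined by their values on the sites.\<close>

definition configurations :: "nat \<Rightarrow> 'c set \<Rightarrow> (nat \<Rightarrow> 'c) set" where
  "configurations n C = {1..n} \<rightarrow>\<^sub>E C"

definition colourings :: "nat \<Rightarrow> 'c set \<Rightarrow> ('c \<times> 'c) set \<Rightarrow> (nat \<Rightarrow> 'c) set" where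
  "colourings n C E = {h \<in> configurations n C. \<forall>i\<in>{1..<n}. (h i, h (i + 1)) \<in> E}"

text \<open>For a bipartite graph there are two admissible state spaces, hence a predicate.\<close>

definition is_state_space :: "nat \<Rightarrow> 'c set \<Rightarrow> ('c \<times> 'c) set \<Rightarrow> (nat \<Rightarrow> 'c) set \<Rightarrow> bool" where
  "is_state_space n C E S \<longleftrightarrow>
     (if bipartite C E
      then \<exists>C1 C2. bipartition C E C1 C2 \<and>
             (S = {x \<in> colourings n C E. x 1 \<in> C1} \<or> S = {x \<in> colourings n C E. x 1 \<in> C2})
      else S = colourings n C E)"


section \<open>Heat-bath block dynamics\<close>

definition block_colourings ::
    "nat \<Rightarrow> 'c set \<Rightarrow> ('c \<times> 'c) set \<Rightarrow> nat set \<Rightarrow> (nat \<Rightarrow> 'c) \<Rightarrow> (nat \<Rightarrow> 'c) set" where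
  "block_colourings n C E \<Lambda> x =
     {y \<in> configurations n C.
        (\<forall>i\<in>{1..n} - \<Lambda>. y i = x i) \<and>
        (\<forall>i\<in>{1..<n}. i \<in> \<Lambda> \<or> i + 1 \<in> \<Lambda> \<longrightarrow> (y i, y (i + 1)) \<in> E)}"

text \<open>The intersection with the state space \<open>S\<close> only matters when \<open>\<Lambda>\<close> contains all sites and the
  graph is bipartite: otherwise a state in \<open>S\<close> and a configuration agreeing with it at some site
  start in the same colour class. For \<open>x \<in> S\<close> the set below contains \<open>x\<close>, so it is nonempty.\<close>

definition heat_bath ::
    "nat \<Rightarrow> 'c set \<Rightarrow> ('c \<times> 'c) set \<Rightarrow> (nat \<Rightarrow> 'c) set \<Rightarrow> nat set \<Rightarrow> (nat \<Rightarrow> 'c) \<Rightarrow> (nat \<Rightarrow> 'c) pmf"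
  where
  "heat_bath n C E S \<Lambda> x = pmf_of_set (block_colourings n C E \<Lambda> x \<inter> S)"

definition random_update ::
    "nat \<Rightarrow> 'c set \<Rightarrow> ('c \<times> 'c) set \<Rightarrow> (nat \<Rightarrow> 'c) set \<Rightarrow> nat set \<Rightarrow> (nat \<Rightarrow> nat set) \<Rightarrow>
     (nat \<Rightarrow> 'c) \<Rightarrow> (nat \<Rightarrow> 'c) pmf" where
  "random_update n C E S I \<Theta> x = bind_pmf (pmf_of_set I) (\<lambda>k. heat_bath n C E S (\<Theta> k) x)"

text \<open>Here \<open>m\<close> is the block length. In the second case the interval may extend beyond the
  last site, and only its elements in \<open>{1..n}\<close> count.\<close>

definition block :: "nat \<Rightarrow> nat \<Rightarrow> nat \<Rightarrow> nat set" where
  "block n m k =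
     (if k \<in> {1..n} then {k..min (k + m - 1) n} else {1..n + m - k} \<inter> {1..n})"


section \<open>Mixing times\<close>

text \<open>A Markov chain is given by its transition kernel \<open>K\<close>, where \<open>K x\<close> is the row of the
  transition matrix at \<open>x\<close>.\<close>

definition chain_distribution :: "('s \<Rightarrow> 's pmf) \<Rightarrow> nat \<Rightarrow> 's \<Rightarrow> 's pmf" where
  "chain_distribution K t x = ((\<lambda>p. bind_pmf p K) ^^ t) (return_pmf x)"

definition tv_dist :: "'s set \<Rightarrow> 's pmf \<Rightarrow> 's pmf \<Rightarrow> real" where
  "tv_dist S p p' = 1 / 2 * (\<Sum>i\<in>S. \<bar>pmf p i - pmf p' i\<bar>)"

text \<open>The mixing time is infinite if from some state the chain never gets \<open>\<epsilon>\<close>-close to \<open>\<pi>\<close>.\<close>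

definition mixing_time :: "'s set \<Rightarrow> ('s \<Rightarrow> 's pmf) \<Rightarrow> 's pmf \<Rightarrow> real \<Rightarrow> enat" where
  "mixing_time S K \<pi> \<epsilon> =
     (SUP x\<in>S. INF t\<in>{t. 0 < t \<and> tv_dist S (chain_distribution K t x) \<pi> \<le> \<epsilon>}. enat t)"

end

theory Submission
  imports Defs "HOL-Real_Asymp.Real_Asymp"
begin

text \<open>Path coupling in dual form. One step of the chain, acting on functions by taking expectations,
  shrinks the Lipschitz constant with respect to the Hamming distance; here configurations range over
  the product of the colour classes \<open>D i\<close>, proper or not, so that any two of them are joined by changes
  at single sites. For two configurations that differ at one site only, the blocks containing that
  site remove the difference, and at most two blocks are adjacent to it. Updating an adjacent block
  samples a random walk of \<^term>\<open>E\<close> started at either of two colours. Any two colours of the same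
  class are joined by a walk of length \<open>4 * q\<close>, so that the two walks can be made to meet within
  every \<open>4 * q\<close> steps with probability at least \<open>1 / q ^ (4 * q)\<close>, and on average
  they disagree in at most \<open>4 * q * q ^ (4 * q)\<close> sites.\<close>

section \<open>Averages\<close>

text \<open>Two colourings need not be joined by changing one site at a time through colourings,
  which obstructs path coupling on the state space itself. Admitting improper configurations has a
  price: a configuration need not be a possible outcome of its own update, so every block must be
  shown to have an outcome; and an edge that has become proper stays proper, so the enlarged chain
  is in general not reversible and stationarity has to be argued on the true state space.

  The bound on the disagreements does not depend on the length of the block, so long blocks win.
  With \<open>m = s * \<gamma>\<close> there are \<open>N = n + m - 1\<close> blocks; for a single
  disagreement, \<open>m\<close> of them remove it, while at most two adjacent ones add at most
  \<open>K = (s - 1) * q ^ (s - 1)\<close> on average. For \<open>q \<ge> 2\<close> the choice of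
  \<open>\<gamma>\<close> makes \<open>m - 2 * K\<close> at least \<open>2 * s\<close>, hence a
  contraction by \<open>1 - 2 * s / N\<close> in each step.\<close>

definition mean :: "'a set \<Rightarrow> ('a \<Rightarrow> real) \<Rightarrow> real" where
  "mean X f = (\<Sum>x\<in>X. f x) / real (card X)"

lemma mean_bij:
  assumes "bij_betw \<psi> X Y"
  shows "mean Y f = mean X (\<lambda>x. f (\<psi> x))"
  using sum.reindex_bij_betw[OF assms, of f] bij_betw_same_card[OF assms] by (simp add: mean_def)

lemma mean_bounds:
  assumes "finite X" "X \<noteq> {}"
  shows "(\<And>x. x \<in> X \<Longrightarrow> f x \<le> b) \<Longrightarrow> mean X f \<le> b"
    and "(\<And>x. x \<in> X \<Longrightarrow> b \<le> f x) \<Longrightarrow> b \<le> mean X f"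
proof -
  have pos: "real (card X) > 0"
    using assms by (simp add: card_gt_0_iff)
  show "mean X f \<le> b" if "\<And>x. x \<in> X \<Longrightarrow> f x \<le> b"
    using sum_bounded_above[of X f b] that pos by (simp add: mean_def field_simps)
  show "b \<le> mean X f" if "\<And>x. x \<in> X \<Longrightarrow> b \<le> f x"
    using sum_bounded_below[of X b f] that pos by (simp add: mean_def field_simps)
qed

text \<open>The independent coupling of two uniform distributions, seen from the test
  functions.\<close>

lemma mean_diff_le:
  assumes "finite X" "X \<noteq> {}" "finite Y" "Y \<noteq> {}"
    and d: "\<And>x y. x \<in> X \<Longrightarrow> y \<in> Y \<Longrightarrow> \<bar>f x - g y\<bar> \<le> d"
  shows "\<bar>mean X f - mean Y g\<bar> \<le> d"
proof -
  have "mean X f \<le> mean Y g + d"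
  proof (rule mean_bounds(1)[OF assms(1,2)])
    fix x assume "x \<in> X"
    have "f x - d \<le> mean Y g"
      by (rule mean_bounds(2)[OF assms(3,4)]) (use d[OF \<open>x \<in> X\<close>] in fastforce)
    then show "f x \<le> mean Y g + d" by simp
  qed
  moreover have "mean Y g - d \<le> mean X f"
  proof (rule mean_bounds(2)[OF assms(1,2)])
    fix x assume "x \<in> X"
    have "mean Y g \<le> f x + d"
      by (rule mean_bounds(1)[OF assms(3,4)]) (use d[OF \<open>x \<in> X\<close>] in fastforce)
    then show "mean Y g - d \<le> f x" by simp
  qed
  ultimately show ?thesis by linarith
qed

text \<open>The identity coupling: the same \<open>x\<close> is used on both sides.\<close>

lemma mean_diff_le_same:
  assumes "finite X" "X \<noteq> {}" and d: "\<And>x. x \<in> X \<Longrightarrow> \<bar>f x - g x\<bar> \<le> d"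
  shows "\<bar>mean X f - mean X g\<bar> \<le> d"
proof -
  have eq: "mean X f - mean X g = mean X (\<lambda>x. f x - g x)"
    by (simp add: mean_def sum_subtractf diff_divide_distrib)
  have "mean X (\<lambda>x. f x - g x) \<le> d"
    by (rule mean_bounds(1)[OF assms(1,2)]) (use d in fastforce)
  moreover have "- d \<le> mean X (\<lambda>x. f x - g x)"
    by (rule mean_bounds(2)[OF assms(1,2)]) (use d in fastforce)
  ultimately show ?thesis unfolding eq by linarith
qed

text \<open>Doeblin's argument in dual form. Mass \<open>p\<close> at \<open>u0\<close> is paired
  with mass \<open>p\<close> at \<open>v0\<close> at cost \<open>A\<close>; the remaining masses,
  \<open>1 - p\<close> on each side, are paired arbitrarily at cost \<open>B\<close>.\<close>

lemma weighted_sum_minorised: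
  fixes \<alpha> m :: "'a \<Rightarrow> real" and \<alpha>' m' :: "'b \<Rightarrow> real"
  assumes fin: "finite U" "finite V"
    and nonneg: "\<And>u. u \<in> U \<Longrightarrow> 0 \<le> \<alpha> u" "\<And>v. v \<in> V \<Longrightarrow> 0 \<le> \<beta> v"
    and sum1: "sum \<alpha> U = 1" "sum \<beta> V = 1"
    and u0: "u0 \<in> U" "p \<le> \<alpha> u0" and v0: "v0 \<in> V" "p \<le> \<beta> v0"
    and diff0: "m u0 - m' v0 \<le> A"
    and diff: "\<And>u v. u \<in> U \<Longrightarrow> v \<in> V \<Longrightarrow> m u - m' v \<le> B"
    and p: "0 \<le> p"
  shows "(\<Sum>u\<in>U. \<alpha> u * m u) - (\<Sum>v\<in>V. \<beta> v * m' v) \<le> p * A + (1 - p) * B"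
proof -
  define r where "r u = \<alpha> u - (if u = u0 then p else 0)" for u
  define r' where "r' v = \<beta> v - (if v = v0 then p else 0)" for v
  have r: "0 \<le> r u" if "u \<in> U" for u using nonneg(1)[OF that] u0 by (auto simp: r_def)
  have r': "0 \<le> r' v" if "v \<in> V" for v using nonneg(2)[OF that] v0 by (auto simp: r'_def)
  have sr: "sum r U = 1 - p" "sum r' V = 1 - p"
    using fin u0(1) v0(1) sum1 by (simp_all add: r_def r'_def sum_subtractf)
  \<comment> \<open>The maximum of \<open>m\<close> separates the two residual sums:
    \<open>b\<close> bounds every \<open>m u\<close> from above and \<open>b - B\<close> bounds
    every \<open>m' v\<close> from below. This replaces a double sum over pairs.\<close>
  define b where "b = Max (m ` U)"
  have b: "m u \<le> b" if "u \<in> U" for u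
    using that fin unfolding b_def by (intro Max_ge) auto
  have "b \<in> m ` U" unfolding b_def using fin u0 by (intro Max_in) auto
  then have b': "b - B \<le> m' v" if "v \<in> V" for v
    using diff that by fastforce
  have "(\<Sum>u\<in>U. r u * m u) \<le> (\<Sum>u\<in>U. r u * b)"
    by (intro sum_mono mult_left_mono b r)
  also have "\<dots> = (1 - p) * b" by (simp add: sr flip: sum_distrib_right)
  finally have 1: "(\<Sum>u\<in>U. r u * m u) \<le> (1 - p) * b" .
  have "(1 - p) * (b - B) = (\<Sum>v\<in>V. r' v * (b - B))" by (simp only: sr flip: sum_distrib_right)
  also have "\<dots> \<le> (\<Sum>v\<in>V. r' v * m' v)"
    by (intro sum_mono mult_left_mono b' r')
  finally have 2: "(1 - p) * (b - B) \<le> (\<Sum>v\<in>V. r' v * m' v)" .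
  have 3: "(\<Sum>u\<in>U. \<alpha> u * m u) = p * m u0 + (\<Sum>u\<in>U. r u * m u)"
  proof -
    have "(\<Sum>u\<in>U. \<alpha> u * m u) = (\<Sum>u\<in>U. (if u = u0 then p * m u0 else 0) + r u * m u)"
      by (rule sum.cong) (auto simp: r_def algebra_simps)
    then show ?thesis using fin u0 by (simp add: sum.distrib)
  qed
  have 4: "(\<Sum>v\<in>V. \<beta> v * m' v) = p * m' v0 + (\<Sum>v\<in>V. r' v * m' v)"
  proof -
    have "(\<Sum>v\<in>V. \<beta> v * m' v) = (\<Sum>v\<in>V. (if v = v0 then p * m' v0 else 0) + r' v * m' v)"
      by (rule sum.cong) (auto simp: r'_def algebra_simps)
    then show ?thesis using fin v0 by (simp add: sum.distrib)
  qed
  have "p * (m u0 - m' v0) \<le> p * A" by (intro mult_left_mono diff0 p)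
  with 1 2 show ?thesis unfolding 3 4 by (simp add: algebra_simps)
qed


section \<open>Percolation of a disagreement along a walk\<close>

text \<open>The starting colour stays out of the list, which thus holds only the colours of updated
  sites. \<open>F\<close> encodes the condition at the far end of a block: the neighbours of the
  fixed colour beyond it, or \<open>UNIV\<close> if the block reaches the end of the path.\<close>

definition walks :: "('c \<times> 'c) set \<Rightarrow> 'c set \<Rightarrow> nat \<Rightarrow> 'c \<Rightarrow> 'c list set" where
  "walks E F L a =
     {w. length w = L \<and> successively (\<lambda>u v. (u, v) \<in> E) (a # w) \<and> last (a # w) \<in> F}"

definition disagreements :: "'a list \<Rightarrow> 'a list \<Rightarrow> nat" where
  "disagreements u v = length (filter (\<lambda>(a, b). a \<noteq> b) (zip u v))"

lemma disagreements_le: "disagreements u v \<le> length u"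
  unfolding disagreements_def by (rule order.trans[OF length_filter_le]) simp

lemma disagreements_append:
  "length u = length u' \<Longrightarrow> disagreements (u @ v) (u' @ v') = disagreements u u' + disagreements v v'"
  by (simp add: disagreements_def)

lemma disagreements_refl [simp]: "disagreements u u = 0"
  by (induction u) (auto simp: disagreements_def)

lemma walks_subset_lists:
  assumes "E \<subseteq> C \<times> C"
  shows "walks E F L a \<subseteq> {w. set w \<subseteq> C \<and> length w = L}"
proof -
  have "successively (\<lambda>u v. (u, v) \<in> E) (a # w) \<Longrightarrow> set w \<subseteq> C" for w
    using assms by (induction w arbitrary: a) auto
  then show ?thesis by (auto simp: walks_def)
qed

lemma finite_walks:
  assumes "E \<subseteq> C \<times> C" "finite C"
  shows "finite (walks E F L a)" "card (walks E F L a) \<le> card C ^ L"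
  unfolding card_lists_length_eq[OF assms(2), symmetric]
  by (rule finite_subset[OF walks_subset_lists[OF assms(1)] finite_lists_length_eq[OF assms(2)]],
      rule card_mono[OF finite_lists_length_eq[OF assms(2)] walks_subset_lists[OF assms(1)]])

lemma walks_relpow: "(\<exists>w\<in>walks E UNIV L a. last (a # w) = c) \<longleftrightarrow> (a, c) \<in> E ^^ L"
proof (induction L arbitrary: a)
  case 0
  then show ?case by (auto simp: walks_def)
next
  case (Suc L)
  have "(\<exists>w\<in>walks E UNIV (Suc L) a. last (a # w) = c) \<longleftrightarrow>
    (\<exists>b. (a, b) \<in> E \<and> (\<exists>w\<in>walks E UNIV L b. last (b # w) = c))"
    by (fastforce simp: walks_def length_Suc_conv)
  also have "\<dots> \<longleftrightarrow> (\<exists>b. (a, b) \<in> E \<and> (b, c) \<in> E ^^ L)"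
    using Suc.IH by blast
  also have "\<dots> \<longleftrightarrow> (a, c) \<in> E ^^ Suc L"
    by (meson relpow_Suc_D2 relpow_Suc_I2)
  finally show ?case .
qed

lemma walks_append:
  "u @ v \<in> walks E F (length u + L) a \<longleftrightarrow>
     u \<in> walks E UNIV (length u) a \<and> v \<in> walks E F L (last (a # u))"
proof -
  have "successively (\<lambda>u v. (u, v) \<in> E) ((a # u) @ v) \<longleftrightarrow>
    successively (\<lambda>u v. (u, v) \<in> E) (a # u) \<and> successively (\<lambda>u v. (u, v) \<in> E) (last (a # u) # v)"
    unfolding successively_append_iff by (cases v) auto
  moreover have "last (a # u @ v) = last (last (a # u) # v)" by (cases v) auto
  ultimately show ?thesis by (auto simp: walks_def)
qed

section \<open>Conditioning a uniform walk on its first steps\<close>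

definition extendable_walks :: "('c \<times> 'c) set \<Rightarrow> 'c set \<Rightarrow> nat \<Rightarrow> nat \<Rightarrow> 'c \<Rightarrow> 'c list set" where
  "extendable_walks E F l L a = {u \<in> walks E UNIV l a. walks E F L (last (a # u)) \<noteq> {}}"

text \<open>A walk splits uniquely into its first \<open>l\<close> steps and the rest. Leaving out
  prefixes without completion loses nothing and keeps later averages over completions away from
  empty sets.\<close>

lemma sum_walks_append:
  fixes g :: "'c list \<Rightarrow> real"
  assumes "E \<subseteq> C \<times> C" "finite C"
  shows "sum g (walks E F (l + L) a) =
    (\<Sum>u\<in>extendable_walks E F l L a. \<Sum>v\<in>walks E F L (last (a # u)). g (u @ v))"
proof -
  have bij: "bij_betw (\<lambda>(u, v). u @ v)
     (SIGMA u:extendable_walks E F l L a. walks E F L (last (a # u))) (walks E F (l + L) a)"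
  proof (rule bij_betw_imageI)
    show "inj_on (\<lambda>(u, v). u @ v) (SIGMA u:extendable_walks E F l L a. walks E F L (last (a # u)))"
      by (auto simp: inj_on_def extendable_walks_def walks_def)
    show "(\<lambda>(u, v). u @ v) ` (SIGMA u:extendable_walks E F l L a. walks E F L (last (a # u))) =
      walks E F (l + L) a"
    proof (intro equalityI subsetI)
      fix w assume w: "w \<in> walks E F (l + L) a"
      define u v where "u = take l w" and "v = drop l w"
      have "w = u @ v" "length u = l" using w by (auto simp: u_def v_def walks_def)
      with w walks_append[of u v E F L a] show
        "w \<in> (\<lambda>(u, v). u @ v) ` (SIGMA u:extendable_walks E F l L a. walks E F L (last (a # u)))"
        by (auto simp: extendable_walks_def)
    next
      fix w assume "w \<in> (\<lambda>(u, v). u @ v) `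
        (SIGMA u:extendable_walks E F l L a. walks E F L (last (a # u)))"
      then obtain u v where "w = u @ v" "u \<in> walks E UNIV l a" "v \<in> walks E F L (last (a # u))"
        by (auto simp: extendable_walks_def)
      moreover then have "length u = l" by (simp add: walks_def)
      ultimately show "w \<in> walks E F (l + L) a"
        using walks_append[of u v E F L a] by auto
    qed
  qed
  have "finite (extendable_walks E F l L a)"
    unfolding extendable_walks_def using finite_walks[OF assms] by auto
  then show ?thesis
    using finite_walks[OF assms]
    by (simp add: sum.Sigma sum.reindex_bij_betw[OF bij, symmetric] case_prod_unfold)
qed

text \<open>In each round of \<open>l\<close> steps both walks can be steered to the same colour
  with probability at least \<open>1 / Q\<close>, where \<open>Q = card C ^ l\<close>, and from
  there they take identical steps. A round costs at most \<open>l\<close> disagreements, so the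
  expected number is at most \<open>l * Q\<close>, whatever \<open>L\<close> and \<open>F\<close>
  are. Two features serve the induction: \<open>e\<close> collects the disagreements of earlier
  rounds, and there are two functions because different prefixes turn one function into two
  functions of the remaining walk.\<close>

lemma percolation:
  fixes g g' :: "'c list \<Rightarrow> real"
  assumes E: "E \<subseteq> C \<times> C" "finite C"
    and closed: "\<And>a u. a \<in> A \<Longrightarrow> u \<in> walks E UNIV l a \<Longrightarrow> last (a # u) \<in> A"
    and conn: "\<And>a c. a \<in> A \<Longrightarrow> c \<in> A \<Longrightarrow> (a, c) \<in> E ^^ l"
    and A: "A \<subseteq> C" and l: "0 < l"
    and a: "a \<in> A" "a' \<in> A" and d: "0 \<le> d"
    and ne: "walks E F L a \<noteq> {}" "walks E F L a' \<noteq> {}"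
    and Lip: "\<And>w w'. w \<in> walks E F L a \<Longrightarrow> w' \<in> walks E F L a' \<Longrightarrow>
       \<bar>g w - g' w'\<bar> \<le> d * (e + real (disagreements w w'))"
  shows "\<bar>mean (walks E F L a) g - mean (walks E F L a') g'\<bar> \<le> d * (e + real l * real (card C) ^ l)"
  using a ne Lip
proof (induction L arbitrary: a a' g g' e rule: less_induct)
  case (less L)
  note fin = finite_walks[OF E]
  have "C \<noteq> {}" using A less.prems(1) by auto
  then have cardC: "1 \<le> real (card C)" using E(2) by (simp add: Suc_leI card_gt_0_iff)
  define Q where "Q = real (card C) ^ l"
  have Q: "1 \<le> Q" unfolding Q_def using cardC by (rule one_le_power)
  show ?case
  proof (cases "L < l")
    case True
    show ?thesis
    proof (rule mean_diff_le[OF fin(1) less.prems(3) fin(1) less.prems(4)])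
      fix w w' assume w: "w \<in> walks E F L a" "w' \<in> walks E F L a'"
      have "real (disagreements w w') \<le> real l"
        using disagreements_le[of w w'] w True by (simp add: walks_def)
      also have "\<dots> \<le> real l * Q" using Q by (simp add: mult_le_cancel_left1)
      finally have "d * (e + real (disagreements w w')) \<le> d * (e + real l * Q)"
        using d by (intro mult_left_mono) auto
      then show "\<bar>g w - g' w'\<bar> \<le> d * (e + real l * real (card C) ^ l)"
        using less.prems(5)[OF w] unfolding Q_def by linarith
    qed
  next
    case False
    define L' where "L' = L - l"
    have L: "L = l + L'" "L' < L" using False l by (auto simp: L'_def)
    \<comment> \<open>\<open>Z c\<close> counts the completions starting from \<open>c\<close>.
      Hence \<open>\<alpha> b u\<close> is the probability that a uniform element of
      \<open>walks E F L b\<close> starts with \<open>u\<close>, and \<open>m b g u\<close> is the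
      mean of \<open>g\<close> given that prefix.\<close>
    define Z where "Z c = real (card (walks E F L' c))" for c
    define U where "U b = extendable_walks E F l L' b" for b
    define \<alpha> where "\<alpha> b u = Z (last (b # u)) / (\<Sum>u\<in>U b. Z (last (b # u)))" for b u
    define m where "m b g u = mean (walks E F L' (last (b # u))) (\<lambda>v. g (u @ v))" for b u
      and g :: "'c list \<Rightarrow> real"
    have finU: "finite (U b)" for b
      unfolding U_def extendable_walks_def using fin by auto
    have Zpos: "0 < Z (last (b # u))" if "u \<in> U b" for b u
      using that fin by (auto simp: U_def extendable_walks_def Z_def card_gt_0_iff)
    have cardL: "real (card (walks E F L b)) = (\<Sum>u\<in>U b. Z (last (b # u)))" for b
      using sum_walks_append[OF E, of "\<lambda>_. 1" F l L' b] by (simp add: L Z_def U_def)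
    have mean_eq: "mean (walks E F L b) g = (\<Sum>u\<in>U b. \<alpha> b u * m b g u)" for b g
    proof -
      have "sum g (walks E F L b) = (\<Sum>u\<in>U b. Z (last (b # u)) * m b g u)"
        unfolding L sum_walks_append[OF E] U_def[symmetric]
      proof (rule sum.cong)
        fix u assume "u \<in> U b"
        then show "(\<Sum>v\<in>walks E F L' (last (b # u)). g (u @ v)) = Z (last (b # u)) * m b g u"
          using Zpos[of u b] by (simp add: m_def mean_def Z_def)
      qed simp
      then show ?thesis
        by (simp add: mean_def cardL \<alpha>_def sum_divide_distrib)
    qed
    have Une: "U b \<noteq> {}" if "walks E F L b \<noteq> {}" for b
    proof
      assume "U b = {}"
      then have "card (walks E F L b) = 0" using cardL[of b] by simp
      then show False using that fin by auto
    qed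
    have sumZ: "0 < (\<Sum>u\<in>U b. Z (last (b # u)))" if "walks E F L b \<noteq> {}" for b
      using Zpos Une[OF that] finU by (intro sum_pos) auto
    have sum\<alpha>: "sum (\<alpha> b) (U b) = 1" if "walks E F L b \<noteq> {}" for b
      using sumZ[OF that] by (simp add: \<alpha>_def flip: sum_divide_distrib)
    have \<alpha>0: "0 \<le> \<alpha> b u" for b u
      unfolding \<alpha>_def Z_def by (intro divide_nonneg_nonneg sum_nonneg) auto
    have lastA: "last (b # u) \<in> A" if "b \<in> A" "u \<in> U b" for b u
      using that closed by (auto simp: U_def extendable_walks_def)
    \<comment> \<open>The colour with the most continuations is reached after \<^term>\<open>l\<close> steps with probability
      at least \<^term>\<open>1 / Q\<close>, whatever the starting colour.\<close>
    obtain c where c: "c \<in> A" and cmax: "\<And>b. b \<in> A \<Longrightarrow> Z b \<le> Z c"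
    proof -
      have "finite (Z ` A)" "Z ` A \<noteq> {}" using A E(2) less.prems(1) by (auto intro: finite_subset)
      then have "Max (Z ` A) \<in> Z ` A" by (rule Max_in)
      then obtain c where "c \<in> A" "Z c = Max (Z ` A)" by auto
      then show thesis using that \<open>finite (Z ` A)\<close> by auto
    qed
    have minor: "\<exists>u\<in>U b. last (b # u) = c \<and> 1 / Q \<le> \<alpha> b u"
      if b: "b \<in> A" "walks E F L b \<noteq> {}" for b
    proof -
      obtain u0 where "u0 \<in> U b" using Une[OF b(2)] by auto
      then have "0 < Z (last (b # u0))" "last (b # u0) \<in> A" using Zpos lastA b by auto
      then have Zc: "0 < Z c" using cmax by force
      obtain u where u: "u \<in> walks E UNIV l b" "last (b # u) = c"
        using conn[OF b(1) c] unfolding walks_relpow[symmetric] by auto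
      have uU: "u \<in> U b"
        using u Zc by (auto simp: U_def extendable_walks_def Z_def card_gt_0_iff)
      \<comment> \<open>There are at most \<open>Q\<close> prefixes, each with at most
        \<open>Z c\<close> completions, and \<open>u\<close> attains \<open>Z c\<close>; this gives
        the lower bound on \<open>\<alpha> b u\<close>.\<close>
      have "(\<Sum>u\<in>U b. Z (last (b # u))) \<le> real (card (U b)) * Z c"
        using sum_bounded_above[of "U b" "\<lambda>u. Z (last (b # u))" "Z c"] cmax lastA[OF b(1)] by simp
      also have "\<dots> \<le> Q * Z c"
      proof (rule mult_right_mono)
        have "card (U b) \<le> card (walks E UNIV l b)"
          unfolding U_def extendable_walks_def using fin by (intro card_mono) auto
        also have "\<dots> \<le> card C ^ l" by (rule fin)
        finally show "real (card (U b)) \<le> Q" unfolding Q_def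
          by (metis of_nat_le_iff of_nat_power)
      qed (use Zc in simp)
      finally have "1 / Q \<le> \<alpha> b u"
        using Q sumZ[OF b(2)] u(2) by (simp add: \<alpha>_def field_simps)
      with u(2) uU show ?thesis by blast
    qed
    obtain u0 where u0: "u0 \<in> U a" "last (a # u0) = c" "1 / Q \<le> \<alpha> a u0"
      using minor less.prems by blast
    obtain v0 where v0: "v0 \<in> U a'" "last (a' # v0) = c" "1 / Q \<le> \<alpha> a' v0"
      using minor less.prems by blast
    have Lip: "\<bar>g (u @ w) - g' (v @ w')\<bar> \<le> d * (e + real l + real (disagreements w w'))"
      if uv: "u \<in> U a" "v \<in> U a'"
        and w: "w \<in> walks E F L' (last (a # u))" "w' \<in> walks E F L' (last (a' # v))" for u v w w'
    proof -
      have len: "length u = l" "length v = l"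
        using uv by (auto simp: U_def extendable_walks_def walks_def)
      have "u @ w \<in> walks E F L a" "v @ w' \<in> walks E F L a'"
        using walks_append[of u w E F L' a] walks_append[of v w' E F L' a'] uv w len
        by (auto simp: U_def extendable_walks_def L)
      then have "\<bar>g (u @ w) - g' (v @ w')\<bar> \<le> d * (e + real (disagreements (u @ w) (v @ w')))"
        by (rule less.prems(5))
      also have "\<dots> \<le> d * (e + real l + real (disagreements w w'))"
        using disagreements_le[of u v] len d
        by (intro mult_left_mono) (auto simp: disagreements_append)
      finally show ?thesis .
    qed
    have diff: "\<bar>m a g u - m a' g' v\<bar> \<le> d * (e + real l + real l * Q)"
      if uv: "u \<in> U a" "v \<in> U a'" for u v
      unfolding m_def Q_def
    proof (rule less.IH[OF L(2)])
      show "last (a # u) \<in> A" "last (a' # v) \<in> A" using lastA uv less.prems by auto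
      show "walks E F L' (last (a # u)) \<noteq> {}" "walks E F L' (last (a' # v)) \<noteq> {}"
        using uv by (auto simp: U_def extendable_walks_def)
    qed (use Lip[OF uv] in auto)
    \<comment> \<open>Both prefixes end in \<open>c\<close>, so their completions are the same set
      and can be paired by the identity.\<close>
    have diff0: "\<bar>m a g u0 - m a' g' v0\<bar> \<le> d * (e + real l)"
      unfolding m_def u0(2) v0(2)
    proof (rule mean_diff_le_same[OF fin(1)])
      show "walks E F L' c \<noteq> {}" using u0 by (auto simp: U_def extendable_walks_def)
      fix w assume "w \<in> walks E F L' c"
      then show "\<bar>g (u0 @ w) - g' (v0 @ w)\<bar> \<le> d * (e + real l)"
        using Lip[OF u0(1) v0(1), of w w] u0 v0 by simp
    qed
    \<comment> \<open>The saving of \<open>l * Q\<close> with probability \<open>1 / Q\<close>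
      exactly offsets the \<open>l\<close> disagreements of the prefix, so the bound reproduces
      itself.\<close>
    have bound: "(1 / Q) * (d * (e + real l)) + (1 - 1 / Q) * (d * (e + real l + real l * Q)) =
        d * (e + real l * Q)"
      using Q by (simp add: field_simps)
    have "mean (walks E F L a) g - mean (walks E F L a') g' \<le>
        (1 / Q) * (d * (e + real l)) + (1 - 1 / Q) * (d * (e + real l + real l * Q))"
      unfolding mean_eq
    proof (rule weighted_sum_minorised[OF finU finU \<alpha>0 \<alpha>0 sum\<alpha> sum\<alpha> u0(1,3) v0(1,3)])
      show "m a g u - m a' g' v \<le> d * (e + real l + real l * Q)" if "u \<in> U a" "v \<in> U a'" for u v
        using diff[OF that] by linarith
    qed (use diff0 Q less.prems in auto)
    moreover have "mean (walks E F L a') g' - mean (walks E F L a) g \<le>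
        (1 / Q) * (d * (e + real l)) + (1 - 1 / Q) * (d * (e + real l + real l * Q))"
      unfolding mean_eq
    proof (rule weighted_sum_minorised[OF finU finU \<alpha>0 \<alpha>0 sum\<alpha> sum\<alpha> v0(1,3) u0(1,3)])
      show "m a' g' v - m a g u \<le> d * (e + real l + real l * Q)" if "v \<in> U a'" "u \<in> U a" for u v
        using diff[OF that(2,1)] by linarith
    qed (use diff0 Q less.prems in auto)
    ultimately show ?thesis unfolding bound Q_def[symmetric] by linarith
  qed
qed


section \<open>Parity classes\<close>

text \<open>A shortest walk visits no vertex twice, since the part between two visits could be cut
  out; its \<open>k + 1\<close> vertices therefore number at most \<open>card C\<close>.\<close>

lemma relpow_lt_card:
  assumes "finite C" "R \<subseteq> C \<times> C" "u \<in> C" "(u, v) \<in> R\<^sup>*"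
  shows "\<exists>k<card C. (u, v) \<in> R ^^ k"
proof -
  define k where "k = (LEAST k. (u, v) \<in> R ^^ k)"
  have "\<exists>k. (u, v) \<in> R ^^ k" using assms(4) by (simp add: rtrancl_power)
  then have k: "(u, v) \<in> R ^^ k" and least: "\<And>j. (u, v) \<in> R ^^ j \<Longrightarrow> k \<le> j"
    unfolding k_def by (auto intro: LeastI_ex Least_le)
  obtain f where f: "f 0 = u" "f k = v" "\<And>i. i < k \<Longrightarrow> (f i, f (Suc i)) \<in> R"
    using k unfolding relpow_fun_conv by auto
  have sub: "(f i, f j) \<in> R ^^ (j - i)" if "i \<le> j" "j \<le> k" for i j
    unfolding relpow_fun_conv using that f(3) by (intro exI[of _ "\<lambda>l. f (i + l)"]) auto
  have "f i \<noteq> f j" if "i < j" "j \<le> k" for i j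
  proof
    assume "f i = f j"
    then have "(u, v) \<in> R ^^ (i + (k - j))"
      using relpow_trans[of u "f i" i R v "k - j"] sub[of 0 i] sub[of j k] that f(1,2) by simp
    then show False using least that by fastforce
  qed
  then have "inj_on f {..k}" by (intro linorder_inj_onI') auto
  moreover have "f ` {..k} \<subseteq> C"
  proof
    fix x assume "x \<in> f ` {..k}"
    then obtain i where "i \<le> k" "x = f i" by auto
    then show "x \<in> C"
      using f assms(2,3) by (cases i) (auto simp: Suc_le_eq)
  qed
  ultimately have "card {..k} \<le> card C" using card_inj_on_le assms(1) by blast
  with k show ?thesis by (auto simp: Suc_le_eq)
qed

text \<open>A walk of even length is a walk of \<open>E O E\<close>, so some such walk has length
  below \<open>2 * card C\<close>. It is padded to the exact length by stepping back and forth along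
  an edge at \<open>v\<close>. The steering in \<open>percolation\<close> requires one length that
  serves all pairs at once.\<close>

lemma even_relpow:
  assumes C: "finite C" and E: "E \<subseteq> C \<times> C" "sym E" and nbr: "\<And>u. u \<in> C \<Longrightarrow> \<exists>w. (u, w) \<in> E"
    and uv: "u \<in> C" "(u, v) \<in> E ^^ m" "even m"
  shows "(u, v) \<in> E ^^ (4 * card C)"
proof -
  have dbl: "E ^^ (2 * j) = (E O E) ^^ j" for j
    by (induction j) (auto simp: O_assoc)
  obtain j where "m = 2 * j" using uv(3) by auto
  then have "(u, v) \<in> (E O E)\<^sup>*"
    using uv(2) dbl by (auto simp: rtrancl_power)
  then obtain k where k: "k < card C" "(u, v) \<in> E ^^ (2 * k)"
    using relpow_lt_card[OF C _ uv(1), of "E O E" v] E(1) dbl by auto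
  have "v \<in> C" using k(2) uv(1) E(1) by (cases "2 * k") auto
  then obtain w where w: "(v, w) \<in> E" "(w, v) \<in> E" using nbr E(2) by (meson symD)
  have "(u, v) \<in> E ^^ (2 * k + 2 * i)" for i
    by (induction i) (use k(2) w in auto)
  moreover have "2 * k + 2 * (2 * card C - k) = 4 * card C" using k(1) by simp
  ultimately show ?thesis by metis
qed

lemma bipartition_relpow:
  assumes "bipartition C E C1 C2" "(u, v) \<in> E ^^ m" "u \<in> C1"
  shows "if even m then v \<in> C1 else v \<in> C2"
  using assms(2)
proof (induction m arbitrary: v)
  case (Suc m)
  then obtain w where "(u, w) \<in> E ^^ m" "(w, v) \<in> E" by auto
  with Suc.IH[of w] assms(1) show ?case
    unfolding bipartition_def by (auto split: if_splits)
qed (use assms in auto)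

text \<open>If no vertex were reached from \<^term>\<open>u\<close> by walks of both parities, the parity of the walks
  would define a bipartition.\<close>

lemma not_bipartite_even_walk:
  assumes "connected_graph C E" "\<not> bipartite C E" "u \<in> C" "v \<in> C"
  shows "\<exists>m. even m \<and> (u, v) \<in> E ^^ m"
proof -
  have E: "E \<subseteq> C \<times> C" "sym E" and conn: "\<And>u v. u \<in> C \<Longrightarrow> v \<in> C \<Longrightarrow> (u, v) \<in> E\<^sup>*"
    using assms(1) by (auto simp: connected_graph_def graph_def)
  define X where "X b = {v \<in> C. \<exists>m. even m = b \<and> (u, v) \<in> E ^^ m}" for b
  have un: "X True \<union> X False = C"
    using conn[OF assms(3)] by (auto simp: X_def rtrancl_power)
  have step: "w' \<in> X (\<not> b)" if "w \<in> X b" "(w, w') \<in> E" for w w' b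
  proof -
    have "\<exists>m. even m = b \<and> (u, w) \<in> E ^^ m" using that(1) unfolding X_def by simp
    then obtain m where "even m = b" "(u, w) \<in> E ^^ m" by (elim exE conjE)
    then have "even (Suc m) = (\<not> b) \<and> (u, w') \<in> E ^^ Suc m" using that by auto
    moreover have "w' \<in> C" using that E by auto
    ultimately show ?thesis unfolding X_def by (intro CollectI conjI exI[of _ "Suc m"]) auto
  qed
  have "X True \<inter> X False \<noteq> {}"
  proof
    assume "X True \<inter> X False = {}"
    moreover have "E \<subseteq> X True \<times> X False \<union> X False \<times> X True"
    proof (rule subrelI)
      fix w w' assume w: "(w, w') \<in> E"
      then have "w \<in> X True \<union> X False" using un E(1) by auto
      then show "(w, w') \<in> X True \<times> X False \<union> X False \<times> X True"
        using step[OF _ w] by fastforce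
    qed
    ultimately have "bipartition C E (X True) (X False)" using un by (simp add: bipartition_def)
    then show False using assms(2) by (auto simp: bipartite_def)
  qed
  then obtain w m m' where w: "w \<in> C" "even m" "(u, w) \<in> E ^^ m" "odd m'" "(u, w) \<in> E ^^ m'"
    by (auto simp: X_def)
  obtain k where k: "(w, v) \<in> E ^^ k" using conn[OF w(1) assms(4)] by (auto simp: rtrancl_power)
  have "(u, v) \<in> E ^^ (m + k)" "(u, v) \<in> E ^^ (m' + k)"
    using relpow_trans w k by fast+
  moreover have "even (m + k) \<or> even (m' + k)" using w by auto
  ultimately show ?thesis by blast
qed

lemma connected_graph_neighbour:
  assumes "connected_graph C E" "2 \<le> card C" "u \<in> C"
  shows "\<exists>w. (u, w) \<in> E"
proof -
  have "\<not> C \<subseteq> {u}" using assms(2) card_mono[of "{u}" C] by auto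
  then obtain v where "v \<in> C" "v \<noteq> u" by auto
  then have "(u, v) \<in> E\<^sup>*" using assms by (auto simp: connected_graph_def)
  then show ?thesis using \<open>v \<noteq> u\<close> by (auto elim: converse_rtranclE)
qed

text \<open>Hides the distinction between bipartite and other graphs: for two or more colours, the
  later arguments see only the class \<open>D i\<close> of each site. All naturals are indices, so
  that the positions 0 and \<open>n + 1\<close> just outside the path have a class too.\<close>

lemma parity_classes:
  fixes C :: "'c set"
  assumes conn: "connected_graph C E" and q: "2 \<le> card C" and S: "is_state_space n C E S" and n: "1 \<le> n"
  shows "\<exists>D::nat \<Rightarrow> 'c set. (\<forall>i. D i \<subseteq> C \<and> D (i + 2) = D i) \<and> (\<forall>i u v. u \<in> D i \<longrightarrow> (u, v) \<in> E \<longrightarrow> v \<in> D (i + 1)) \<and>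
    (\<forall>i. \<forall>u\<in>D i. \<forall>v\<in>D i. (u, v) \<in> E ^^ (4 * card C)) \<and> S = {x \<in> colourings n C E. x 1 \<in> D 1}"
proof -
  have C: "finite C" and E: "E \<subseteq> C \<times> C" "sym E"
    and path: "\<And>u v. u \<in> C \<Longrightarrow> v \<in> C \<Longrightarrow> \<exists>m. (u, v) \<in> E ^^ m"
    using conn by (auto simp: connected_graph_def graph_def rtrancl_power)
  note even = even_relpow[OF C E connected_graph_neighbour[OF conn q]]
  show ?thesis
  proof (cases "bipartite C E")
    case False
    show ?thesis
    proof (rule exI[of _ "\<lambda>_. C"], intro conjI allI ballI impI)
      show "(u, v) \<in> E ^^ (4 * card C)" if "u \<in> C" "v \<in> C" for u v
        using not_bipartite_even_walk[OF conn False that] even that by blast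
      have "x 1 \<in> C" if "x \<in> colourings n C E" for x
        using that n by (auto simp: colourings_def configurations_def)
      then show "S = {x \<in> colourings n C E. x 1 \<in> C}"
        using S False by (auto simp: is_state_space_def)
    qed (use E in auto)
  next
    case True
    have swap: "bipartition C E C2 C1" if "bipartition C E C1 C2" for C1 C2
      using that by (auto simp: bipartition_def)
    \<comment> \<open>Swapping the names of the classes covers both admissible state spaces, so site
      1 may be taken to have its colour in \<open>C1\<close>.\<close>
    have "\<exists>C1 C2. bipartition C E C1 C2 \<and> S = {x \<in> colourings n C E. x 1 \<in> C1}"
      using S True swap unfolding is_state_space_def if_P[OF True] by blast
    then obtain C1 C2 where bip: "bipartition C E C1 C2"
      and S: "S = {x \<in> colourings n C E. x 1 \<in> C1}"
      by blast
    have bip': "bipartition C E C2 C1" using bip by (auto simp: bipartition_def)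
    have sub: "C1 \<subseteq> C" "C2 \<subseteq> C" "C1 \<inter> C2 = {}" and
      E12: "E \<subseteq> C1 \<times> C2 \<union> C2 \<times> C1" using bip by (auto simp: bipartition_def)
    have conn12: "(u, v) \<in> E ^^ (4 * card C)"
      if b: "bipartition C E B B'" and uv: "u \<in> B" "v \<in> B" for B B' u v
    proof -
      have B: "B \<subseteq> C" "B \<inter> B' = {}" using b by (auto simp: bipartition_def)
      with uv obtain m where m: "(u, v) \<in> E ^^ m" using path by blast
      then have "even m" using bipartition_relpow[OF b m uv(1)] uv B by (auto split: if_splits)
      then show ?thesis using even m uv B by blast
    qed
    show ?thesis
    proof (rule exI[of _ "\<lambda>i. if odd i then C1 else C2"], intro conjI allI ballI impI)
      show "(u, v) \<in> E ^^ (4 * card C)"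
        if "u \<in> (if odd i then C1 else C2)" "v \<in> (if odd i then C1 else C2)" for u v and i :: nat
        using that conn12[OF bip] conn12[OF bip'] by (auto split: if_splits)
      show "v \<in> (if odd (i + 1) then C1 else C2)"
        if "u \<in> (if odd i then C1 else C2)" "(u, v) \<in> E" for u v and i :: nat
        using that E12 sub by (auto split: if_splits)
    qed (use sub S in auto)
  qed
qed


section \<open>Heat-bath moves on intervals\<close>

definition hamming :: "nat \<Rightarrow> (nat \<Rightarrow> 'a) \<Rightarrow> (nat \<Rightarrow> 'a) \<Rightarrow> nat" where
  "hamming n x y = card {j \<in> {1..n}. x j \<noteq> y j}"

lemma successively_map_upt:
  "successively R (map z [a..<b]) \<longleftrightarrow> (\<forall>e. a \<le> e \<and> Suc e < b \<longrightarrow> R (z e) (z (Suc e)))"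
proof (intro iffI allI impI)
  fix e assume s: "successively R (map z [a..<b])" and e: "a \<le> e \<and> Suc e < b"
  then have "Suc (e - a) < b - a" by linarith
  with successively_nth[OF s, of "e - a"] e show "R (z e) (z (Suc e))" by simp
qed (auto simp: successively_conv_nth)

lemma disagreements_map:
  assumes "distinct js"
  shows "disagreements (map x js) (map y js) = card {j \<in> set js. x j \<noteq> y j}"
proof -
  have "disagreements (map x js) (map y js) = length (filter (\<lambda>j. x j \<noteq> y j) js)"
    unfolding disagreements_def by (induction js) auto
  also have "\<dots> = card {j \<in> set js. x j \<noteq> y j}"
    using distinct_card[OF distinct_filter[OF assms]] by (metis set_filter)
  finally show ?thesis .
qed

text \<open>\<^term>\<open>D i\<close> is the set of colours allowed at site \<^term>\<open>i\<close>: one of the two colour classes,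
  alternating with \<^term>\<open>i\<close>, or \<^term>\<open>C\<close> if the graph is not bipartite.\<close>

locale path_dynamics =
  fixes n m l :: nat and C :: "'c set" and E :: "('c \<times> 'c) set" and D :: "nat \<Rightarrow> 'c set"
  assumes finite_C: "finite C" and E_sub: "E \<subseteq> C \<times> C" and sym_E: "sym E"
    and neighbour: "\<And>u. u \<in> C \<Longrightarrow> \<exists>v. (u, v) \<in> E"
    and D_sub: "\<And>i. D i \<subseteq> C" and D_period: "\<And>i. D (i + 2) = D i"
    and D_step: "\<And>i u v. u \<in> D i \<Longrightarrow> (u, v) \<in> E \<Longrightarrow> v \<in> D (i + 1)"
    and D_conn: "\<And>i u v. u \<in> D i \<Longrightarrow> v \<in> D i \<Longrightarrow> (u, v) \<in> E ^^ l"
    and even_l: "even l" and l_pos: "0 < l" and l_le_m: "l \<le> m" and n_pos: "1 \<le> n"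
begin

definition Om :: "(nat \<Rightarrow> 'c) set" where
  "Om = PiE {1..n} D"

text \<open>The outcomes of a heat-bath move with \<open>Om\<close> as state space, which makes
  sense for improper starting configurations as well. From a true state the outcomes are the same as
  before, see \<open>state_moves\<close>.\<close>

definition moves :: "nat set \<Rightarrow> (nat \<Rightarrow> 'c) \<Rightarrow> (nat \<Rightarrow> 'c) set" where
  "moves \<Lambda> x = block_colourings n C E \<Lambda> x \<inter> Om"

definition K :: real where
  "K = real l * real (card C) ^ l"

lemma K_nonneg: "0 \<le> K"
  by (simp add: K_def)

lemma finite_Om: "finite Om"
  unfolding Om_def using D_sub finite_C by (intro finite_PiE) (auto intro: finite_subset)

lemma finite_moves: "finite (moves \<Lambda> x)"
  unfolding moves_def using finite_Om by auto

lemma moves_iff: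
  "z \<in> moves \<Lambda> x \<longleftrightarrow> z \<in> Om \<and> (\<forall>j\<in>{1..n} - \<Lambda>. z j = x j) \<and>
     (\<forall>e\<in>{1..<n}. e \<in> \<Lambda> \<or> e + 1 \<in> \<Lambda> \<longrightarrow> (z e, z (e + 1)) \<in> E)"
proof -
  have "Om \<subseteq> configurations n C"
    unfolding Om_def configurations_def using D_sub by (intro PiE_mono) auto
  then show ?thesis unfolding moves_def block_colourings_def by auto
qed

lemma D_parity: "even (i + j) \<Longrightarrow> D i = D j"
proof -
  have *: "D (i + 2 * k) = D i" for i k
  proof (induction k)
    case (Suc k)
    then show ?case using D_period[of "i + 2 * k"] by (simp add: add.assoc)
  qed simp
  have le: "D i = D j" if "i \<le> j" "even (i + j)" for i j
  proof -
    have "even (j - i)" using that by simp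
    then obtain k where "j - i = 2 * k" by (rule dvdE)
    then have "j = i + 2 * k" using that(1) by linarith
    then show ?thesis using * by simp
  qed
  assume "even (i + j)"
  then show ?thesis using le[of i j] le[of j i] by (metis add.commute nat_le_linear)
qed

lemma D_relpow: "(u, v) \<in> E ^^ k \<Longrightarrow> u \<in> D i \<Longrightarrow> v \<in> D (i + k)"
  by (induction k arbitrary: v) (use D_step in force)+

section \<open>Moves on a block beside a site, read as walks\<close>

lemma D_walk:
  assumes "w \<in> walks E F L a" "a \<in> D i" "k < L"
  shows "w ! k \<in> D (i + 1 + k)"
proof -
  have s: "successively (\<lambda>u v. (u, v) \<in> E) (a # w)" "length w = L" using assms(1) by (auto simp: walks_def)
  have "(a # w) ! k \<in> D (i + k)" if "k \<le> L" for k
    using that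
  proof (induction k)
    case 0
    then show ?case using assms(2) by simp
  next
    case (Suc k)
    have "((a # w) ! k, (a # w) ! Suc k) \<in> E"
      using successively_nth[OF s(1), of k] s(2) Suc.prems by simp
    then show ?case using D_step[of "(a # w) ! k" "i + k"] Suc by simp
  qed
  from this[of "Suc k"] show ?thesis using assms(3) by simp
qed

text \<open>Common core of the moves to the right and to the left of \<open>i\<close>. The list
  \<open>js\<close> names the sites of the block in the order in which a walk leaving
  \<open>i\<close> meets them. The class of a site depends only on its parity, so
  \<open>parity\<close> also covers walks towards smaller sites.\<close>

lemma moves_bij_walks:
  assumes x: "x \<in> Om" and i: "i \<in> {1..n}"
    and js: "distinct js" "set js \<subseteq> {1..n}"
    and parity: "\<And>k. k < length js \<Longrightarrow> even (i + 1 + k + js ! k)"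
    and edges: "\<And>z. (\<And>j. j \<in> {1..n} \<Longrightarrow> j \<notin> set js \<Longrightarrow> z j = x j) \<Longrightarrow>
       (\<forall>e\<in>{1..<n}. e \<in> set js \<or> e + 1 \<in> set js \<longrightarrow> (z e, z (e + 1)) \<in> E) \<longleftrightarrow>
       map z js \<in> walks E F (length js) (x i)"
  shows "bij_betw (\<lambda>z. map z js) (moves (set js) x) (walks E F (length js) (x i))"
proof (rule bij_betw_imageI)
  show "inj_on (\<lambda>z. map z js) (moves (set js) x)"
  proof (rule inj_onI, rule ext)
    fix z z' j assume z: "z \<in> moves (set js) x" "z' \<in> moves (set js) x" "map z js = map z' js"
    then show "z j = z' j"
      by (cases "j \<in> set js"; cases "j \<in> {1..n}")
        (auto simp: moves_iff Om_def PiE_def extensional_def)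
  qed
  show "(\<lambda>z. map z js) ` moves (set js) x = walks E F (length js) (x i)"
  proof (intro equalityI subsetI)
    fix w assume w: "w \<in> walks E F (length js) (x i)"
    then have len: "length js = length w" by (simp add: walks_def)
    define z where "z j = (if j \<in> set js then the (map_of (zip js w) j) else x j)" for j
    have zk: "z (js ! k) = w ! k" if "k < length js" for k
      using map_of_zip_nth[OF len js(1), of k] that len by (auto simp: z_def)
    have map: "map z js = w" using len zk by (intro nth_equalityI) auto
    have "z \<in> Om" unfolding Om_def
    proof (rule PiE_I)
      fix j assume j: "j \<in> {1..n}"
      show "z j \<in> D j"
      proof (cases "j \<in> set js")
        case True
        then obtain k where k: "k < length js" "j = js ! k" by (metis in_set_conv_nth)
        have "x i \<in> D i" using x i by (auto simp: Om_def)
        then have "w ! k \<in> D (i + 1 + k)" using D_walk[OF w _ k(1)] by blast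
        then show ?thesis using D_parity[OF parity[OF k(1)]] zk k by simp
      next
        case False
        then show ?thesis using x j by (auto simp: z_def Om_def)
      qed
    next
      fix j assume "j \<notin> {1..n}"
      then show "z j = undefined" using x js(2) by (auto simp: z_def Om_def PiE_def extensional_def)
    qed
    moreover have "z j = x j" if "j \<notin> set js" for j using that by (simp add: z_def)
    ultimately have "z \<in> moves (set js) x" using edges[of z] w unfolding moves_iff map by auto
    then show "w \<in> (\<lambda>z. map z js) ` moves (set js) x" using map by force
  next
    fix w assume "w \<in> (\<lambda>z. map z js) ` moves (set js) x"
    then obtain z where z: "z \<in> moves (set js) x" "w = map z js" by auto
    then show "w \<in> walks E F (length js) (x i)" using edges[of z] by (auto simp: moves_iff)
  qed
qed

definition Lip :: "real \<Rightarrow> ((nat \<Rightarrow> 'c) \<Rightarrow> real) \<Rightarrow> bool" where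
  "Lip d f \<longleftrightarrow> (\<forall>x\<in>Om. \<forall>y\<in>Om. \<bar>f x - f y\<bar> \<le> d * real (hamming n x y))"

text \<open>Transports \<open>percolation\<close> along the bijections with walks. The 1 in front of
  \<open>K\<close> pays for site \<open>i\<close>, where the two outcomes may still differ; it is
  the initial value of the offset \<open>e\<close>.\<close>

lemma mean_moves_percolation:
  assumes x: "x \<in> Om" and y: "y \<in> Om" and i: "i \<in> {1..n}"
    and agree: "\<And>j. j \<noteq> i \<Longrightarrow> x j = y j"
    and js: "distinct js"
    and bij: "bij_betw (\<lambda>z. map z js) (moves (set js) x) (walks E F (length js) (x i))"
      "bij_betw (\<lambda>z. map z js) (moves (set js) y) (walks E F (length js) (y i))"
    and ne: "moves (set js) x \<noteq> {}" "moves (set js) y \<noteq> {}"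
    and f: "Lip d f" and d: "0 \<le> d"
  shows "\<bar>mean (moves (set js) x) f - mean (moves (set js) y) f\<bar> \<le> d * (1 + K)"
proof -
  \<comment> \<open>\<open>\<psi> x\<close> turns a walk back into an outcome of the update of
    \<open>x\<close>. Composing \<open>f\<close> with \<open>\<psi> x\<close> and with
    \<open>\<psi> y\<close> gives the two functions that \<open>percolation\<close>
    compares.\<close>
  define \<psi> where "\<psi> x = inv_into (moves (set js) x) (\<lambda>z. map z js)" for x
  have \<psi>: "\<psi> x w \<in> moves (set js) x \<and> map (\<psi> x w) js = w"
    if "bij_betw (\<lambda>z. map z js) (moves (set js) x) W" "w \<in> W" for x w W
    using that bij_betw_imp_surj_on[OF that(1)]
    by (metis \<psi>_def f_inv_into_f inv_into_into)
  have eq: "mean (moves (set js) x) f = mean W (\<lambda>w. f (\<psi> x w))"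
    if "bij_betw (\<lambda>z. map z js) (moves (set js) x) W" for x W
    unfolding \<psi>_def by (rule mean_bij[OF bij_betw_inv_into[OF that]])
  have "\<bar>mean (walks E F (length js) (x i)) (\<lambda>w. f (\<psi> x w)) -
      mean (walks E F (length js) (y i)) (\<lambda>w. f (\<psi> y w))\<bar> \<le> d * (1 + real l * real (card C) ^ l)"
  proof (rule percolation[OF E_sub finite_C _ _ D_sub l_pos _ _ d])
    show "last (a # u) \<in> D i" if "a \<in> D i" "u \<in> walks E UNIV l a" for a u
    proof -
      have "(a, last (a # u)) \<in> E ^^ l" using that(2) walks_relpow[of E l a] by blast
      then have "last (a # u) \<in> D (i + l)" using D_relpow that(1) by blast
      then show ?thesis using D_parity[of "i + l" i] even_l by simp
    qed
    show "(a, c) \<in> E ^^ l" if "a \<in> D i" "c \<in> D i" for a c using D_conn that .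
    show "x i \<in> D i" "y i \<in> D i" using x y i by (auto simp: Om_def)
    show "walks E F (length js) (x i) \<noteq> {}" "walks E F (length js) (y i) \<noteq> {}"
      using ne bij by (auto simp: bij_betw_def)
    fix w w' assume w: "w \<in> walks E F (length js) (x i)" "w' \<in> walks E F (length js) (y i)"
    define z z' where "z = \<psi> x w" and "z' = \<psi> y w'"
    have z: "z \<in> moves (set js) x" "map z js = w" "z' \<in> moves (set js) y" "map z' js = w'"
      using \<psi>[OF bij(1) w(1)] \<psi>[OF bij(2) w(2)] by (auto simp: z_def z'_def)
    have "{j \<in> {1..n}. z j \<noteq> z' j} \<subseteq> insert i {j \<in> set js. z j \<noteq> z' j}"
    proof
      fix j assume j: "j \<in> {j \<in> {1..n}. z j \<noteq> z' j}"
      show "j \<in> insert i {j \<in> set js. z j \<noteq> z' j}"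
        using z(1,3) j agree[of j] by (cases "j \<in> set js"; cases "j = i") (auto simp: moves_iff)
    qed
    then have "hamming n z z' \<le> card (insert i {j \<in> set js. z j \<noteq> z' j})"
      unfolding hamming_def by (intro card_mono) auto
    also have "\<dots> \<le> 1 + disagreements w w'"
      using card_insert_le_m1[of "1 + card {j \<in> set js. z j \<noteq> z' j}" "{j \<in> set js. z j \<noteq> z' j}" i]
        disagreements_map[OF js, of z z'] z by simp
    finally have "real (hamming n z z') \<le> 1 + real (disagreements w w')" by linarith
    then have "d * real (hamming n z z') \<le> d * (1 + real (disagreements w w'))"
      using d by (rule mult_left_mono)
    moreover have "\<bar>f z - f z'\<bar> \<le> d * real (hamming n z z')"
      using f z by (auto simp: Lip_def moves_iff)
    ultimately show "\<bar>f (\<psi> x w) - f (\<psi> y w')\<bar> \<le> d * (1 + real (disagreements w w'))"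
      unfolding z_def z'_def by linarith
  qed
  then show ?thesis unfolding eq[OF bij(1)] eq[OF bij(2)] K_def .
qed

lemma moves_bij_walks_right:
  assumes x: "x \<in> Om" and i: "1 \<le> i" "i < r" "r \<le> n"
  shows "bij_betw (\<lambda>z. map z [i + 1..<r + 1]) (moves {i + 1..r} x)
    (walks E (if r < n then {c. (c, x (r + 1)) \<in> E} else UNIV) (r - i) (x i))"
proof -
  have set: "set [i + 1..<r + 1] = {i + 1..r}" by auto
  have "bij_betw (\<lambda>z. map z [i + 1..<r + 1]) (moves (set [i + 1..<r + 1]) x)
    (walks E (if r < n then {c. (c, x (r + 1)) \<in> E} else UNIV) (length [i + 1..<r + 1]) (x i))"
  proof (rule moves_bij_walks[OF x])
    fix z assume agree: "\<And>j. j \<in> {1..n} \<Longrightarrow> j \<notin> set [i + 1..<r + 1] \<Longrightarrow> z j = x j"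
    have xi: "x i = z i" using agree[of i] i by simp
    have up: "x i # map z [i + 1..<r + 1] = map z [i..<r + 1]"
      using i xi by (subst (2) upt_conv_Cons) auto
    have last: "last (map z [i..<r + 1]) = z r" using i by simp
    have "map z [i + 1..<r + 1] \<in> walks E (if r < n then {c. (c, x (r + 1)) \<in> E} else UNIV)
        (length [i + 1..<r + 1]) (x i) \<longleftrightarrow>
      (\<forall>e. i \<le> e \<and> e < r \<longrightarrow> (z e, z (Suc e)) \<in> E) \<and> (r < n \<longrightarrow> (z r, x (r + 1)) \<in> E)"
      unfolding walks_def mem_Collect_eq up last successively_map_upt by auto
    moreover have "z (r + 1) = x (r + 1)" if "r < n" using agree[of "r + 1"] that by simp
    moreover have "(\<forall>e\<in>{1..<n}. e \<in> {i + 1..r} \<or> e + 1 \<in> {i + 1..r} \<longrightarrow> P e) \<longleftrightarrow>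
      (\<forall>e. i \<le> e \<and> e < r \<longrightarrow> P e) \<and> (r < n \<longrightarrow> P r)" for P
    proof -
      have "e \<in> {1..<n} \<and> (e \<in> {i + 1..r} \<or> e + 1 \<in> {i + 1..r}) \<longleftrightarrow>
        i \<le> e \<and> e < r \<or> e = r \<and> r < n" for e
        using i by auto
      then show ?thesis by blast
    qed
    ultimately show "(\<forall>e\<in>{1..<n}. e \<in> set [i + 1..<r + 1] \<or> e + 1 \<in> set [i + 1..<r + 1] \<longrightarrow>
         (z e, z (e + 1)) \<in> E) \<longleftrightarrow>
      map z [i + 1..<r + 1] \<in> walks E (if r < n then {c. (c, x (r + 1)) \<in> E} else UNIV)
        (length [i + 1..<r + 1]) (x i)"
      unfolding set by auto
  qed (use i in \<open>auto simp del: upt_Suc\<close>)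
  then show ?thesis unfolding set by (simp del: upt_Suc)
qed

text \<open>The walk runs from \<open>i\<close> towards smaller sites, hence the reversed list;
  symmetry of \<open>E\<close> turns its steps into edges of the path.\<close>

lemma moves_bij_walks_left:
  assumes x: "x \<in> Om" and i: "1 \<le> r" "r < i" "i \<le> n"
  shows "bij_betw (\<lambda>z. map z (rev [r..<i])) (moves {r..<i} x)
    (walks E (if 1 < r then {c. (c, x (r - 1)) \<in> E} else UNIV) (i - r) (x i))"
proof -
  have set: "set (rev [r..<i]) = {r..<i}" by auto
  have sym: "(u, v) \<in> E \<longleftrightarrow> (v, u) \<in> E" for u v using sym_E by (meson symD)
  have "bij_betw (\<lambda>z. map z (rev [r..<i])) (moves (set (rev [r..<i])) x)
    (walks E (if 1 < r then {c. (c, x (r - 1)) \<in> E} else UNIV) (length (rev [r..<i])) (x i))"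
  proof (rule moves_bij_walks[OF x])
    fix z assume agree: "\<And>j. j \<in> {1..n} \<Longrightarrow> j \<notin> set (rev [r..<i]) \<Longrightarrow> z j = x j"
    have xi: "x i = z i" using agree[of i] i by simp
    have down: "x i # map z (rev [r..<i]) = rev (map z [r..<i + 1])"
      using i xi by (simp add: rev_map)
    have last: "last (rev (map z [r..<i + 1])) = z r"
      using i by (simp add: last_rev hd_map del: upt_Suc)
    have "map z (rev [r..<i]) \<in> walks E (if 1 < r then {c. (c, x (r - 1)) \<in> E} else UNIV)
        (length (rev [r..<i])) (x i) \<longleftrightarrow>
      (\<forall>e. r \<le> e \<and> e < i \<longrightarrow> (z e, z (Suc e)) \<in> E) \<and> (1 < r \<longrightarrow> (x (r - 1), z r) \<in> E)"
      unfolding walks_def mem_Collect_eq down last successively_rev successively_map_upt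
      using sym by auto
    moreover have "z (r - 1) = x (r - 1)" if "1 < r" using agree[of "r - 1"] that i by simp
    moreover have "(\<forall>e\<in>{1..<n}. e \<in> {r..<i} \<or> e + 1 \<in> {r..<i} \<longrightarrow> P e) \<longleftrightarrow>
      (\<forall>e. r \<le> e \<and> e < i \<longrightarrow> P e) \<and> (1 < r \<longrightarrow> P (r - 1))" for P
    proof -
      have "e \<in> {1..<n} \<and> (e \<in> {r..<i} \<or> e + 1 \<in> {r..<i}) \<longleftrightarrow>
        r \<le> e \<and> e < i \<or> e = r - 1 \<and> 1 < r" for e
        using i by auto
      then show ?thesis by blast
    qed
    ultimately show "(\<forall>e\<in>{1..<n}. e \<in> set (rev [r..<i]) \<or> e + 1 \<in> set (rev [r..<i]) \<longrightarrow>
         (z e, z (e + 1)) \<in> E) \<longleftrightarrow>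
      map z (rev [r..<i]) \<in> walks E (if 1 < r then {c. (c, x (r - 1)) \<in> E} else UNIV)
        (length (rev [r..<i])) (x i)"
      unfolding set by auto
  qed (use i in \<open>auto simp: rev_nth\<close>)
  then show ?thesis unfolding set by simp
qed

section \<open>Filling a block between prescribed boundary colours\<close>

lemma walk_forward: "u \<in> D i \<Longrightarrow> \<exists>v\<in>D (i + k). (u, v) \<in> E ^^ k"
proof (induction k)
  case (Suc k)
  then obtain v where v: "v \<in> D (i + k)" "(u, v) \<in> E ^^ k" by auto
  then obtain w where "(v, w) \<in> E" using neighbour D_sub by blast
  then show ?case using v D_step[of v "i + k" w] by auto
qed auto

lemma relpow_sym: "(u, v) \<in> E ^^ k \<Longrightarrow> (v, u) \<in> E ^^ k"
proof (induction k arbitrary: v)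
  case (Suc k)
  then obtain w where "(u, w) \<in> E ^^ k" "(w, v) \<in> E" by auto
  then show ?case using Suc.IH[of w] sym_E by (meson relpow_Suc_I2 symD)
qed auto

text \<open>The first \<open>k - l\<close> steps are arbitrary; the last \<open>l\<close> steps lead
  to the prescribed end within its class.\<close>

lemma walk_between:
  assumes "u \<in> D i" "v \<in> D (i + k)" "l \<le> k"
  shows "(u, v) \<in> E ^^ k"
proof -
  obtain w where w: "w \<in> D (i + (k - l))" "(u, w) \<in> E ^^ (k - l)" using walk_forward assms(1) by blast
  have "D (i + (k - l)) = D (i + k)" using even_l assms(3) by (intro D_parity) auto
  then have "(w, v) \<in> E ^^ l" using w(1) assms(2) D_conn by auto
  with w(2) have "(u, v) \<in> E ^^ (k - l + l)" by (rule relpow_trans)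
  then show ?thesis using assms(3) by simp
qed

text \<open>As \<open>x\<close> may be improper, it need not be an outcome of its own update, so an
  outcome has to be built. A block with fixed sites on both sides has length at least
  \<open>m \<ge> l\<close>, enough to connect the two boundary colours; a block reaching an end of
  the path is free there.\<close>

lemma moves_nonempty:
  assumes x: "x \<in> Om" and lo: "1 \<le> lo" "lo \<le> hi" "hi \<le> n"
    and long: "lo = 1 \<or> hi = n \<or> m \<le> hi + 1 - lo"
  shows "moves {lo..hi} x \<noteq> {}"
proof -
  have xD: "x j \<in> D j" if "j \<in> {1..n}" for j using that x by (auto simp: Om_def)
  \<comment> \<open>The number of steps from site \<open>lo - 1\<close> to site
    \<open>hi + 1\<close>. Either may be a virtual site, 0 or \<open>n + 1\<close>, whose colour is
    restricted only by its class and by the walk.\<close>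
  define k where "k = hi + 2 - lo"
  have k: "lo - 1 + k = hi + 1" using lo by (simp add: k_def)
  have "\<exists>u\<in>D (lo - 1). \<exists>v. (u, v) \<in> E ^^ k \<and> (1 < lo \<longrightarrow> u = x (lo - 1)) \<and> (hi < n \<longrightarrow> v = x (hi + 1))"
  proof (cases "1 < lo")
    case True
    have u: "x (lo - 1) \<in> D (lo - 1)" by (intro xD) (use lo True in auto)
    show ?thesis
    proof (cases "hi < n")
      case hi: True
      then have "l \<le> k" using long True l_le_m by (auto simp: k_def)
      moreover have "x (hi + 1) \<in> D (lo - 1 + k)" unfolding k using xD hi by simp
      ultimately have "(x (lo - 1), x (hi + 1)) \<in> E ^^ k" using walk_between u by blast
      then show ?thesis using u by blast
    next
      case False
      then show ?thesis using walk_forward[OF u, of k] u by blast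
    qed
  next
    case False
    then have lo1: "lo = 1" using lo by simp
    show ?thesis
    proof (cases "hi < n")
      case True
      then have "x (hi + 1) \<in> D (hi + 1)" using xD by simp
      then obtain u where u: "u \<in> D (hi + 1 + k)" "(x (hi + 1), u) \<in> E ^^ k"
        using walk_forward by blast
      \<comment> \<open>The walk was built backwards from the right boundary;
        \<open>hi + 1 + k\<close> and \<open>lo - 1\<close> differ by \<open>2 * k\<close>.\<close>
      have "D (hi + 1 + k) = D (lo - 1)" by (rule D_parity) (use k in presburger)
      then have "u \<in> D (lo - 1)" using u by simp
      then show ?thesis using relpow_sym[OF u(2)] False by blast
    next
      case hi: False
      \<comment> \<open>The block is the whole path. The virtual site 0 gets a colour from
        \<open>D 0 = D 2\<close>, which contains a neighbour of \<open>x 1\<close>.\<close>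
      have "x 1 \<in> D 1" using xD n_pos by simp
      then obtain u where "u \<in> D (1 + 1)" using walk_forward[of "x 1" 1 1] by blast
      then have u: "u \<in> D (lo - 1)" using D_period[of 0] lo1 by (simp add: numeral_2_eq_2)
      show ?thesis using walk_forward[OF u, of k] u False hi by blast
    qed
  qed
  then obtain u v where u: "u \<in> D (lo - 1)" and uv: "(u, v) \<in> E ^^ k"
    and ux: "1 < lo \<Longrightarrow> u = x (lo - 1)" and vx: "hi < n \<Longrightarrow> v = x (hi + 1)" by blast
  obtain g where g: "g 0 = u" "g k = v" "\<And>i. i < k \<Longrightarrow> (g i, g (Suc i)) \<in> E"
    using uv unfolding relpow_fun_conv by auto
  have gD: "i \<le> k \<Longrightarrow> g i \<in> D (lo - 1 + i)" for i
  proof (induction i)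
    case (Suc i)
    then show ?case using D_step[of "g i" "lo - 1 + i" "g (Suc i)"] g(3)[of i] by simp
  qed (use u g in simp)
  define y where "y j = (if j \<in> {lo..hi} then g (j + 1 - lo) else x j)" for j
  have yg: "y j = g (j + 1 - lo)" if j: "1 \<le> j" "j \<le> n" "lo \<le> j + 1" "j \<le> hi + 1" for j
  proof -
    consider "j \<in> {lo..hi}" | "j + 1 = lo" | "j = hi + 1" using j by fastforce
    then show ?thesis
    proof cases
      case 2
      then show ?thesis using ux g j by (auto simp: y_def)
    next
      case 3
      then show ?thesis using vx g j lo by (auto simp: y_def k_def)
    qed (simp add: y_def)
  qed
  have "y \<in> moves {lo..hi} x"
    unfolding moves_iff
  proof (intro conjI ballI impI)
    show "y \<in> Om" unfolding Om_def
    proof (rule PiE_I)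
      fix j assume j: "j \<in> {1..n}"
      show "y j \<in> D j"
      proof (cases "j \<in> {lo..hi}")
        case True
        have "lo - 1 + (j + 1 - lo) = j" using lo True by auto
        then show ?thesis using True gD[of "j + 1 - lo"] by (auto simp: y_def k_def)
      qed (use xD j in \<open>auto simp: y_def\<close>)
    next
      fix j assume "j \<notin> {1..n}"
      then show "y j = undefined" using x lo by (auto simp: y_def Om_def PiE_def extensional_def)
    qed
    show "y j = x j" if "j \<in> {1..n} - {lo..hi}" for j using that by (auto simp: y_def)
    fix e assume e: "e \<in> {1..<n}" "e \<in> {lo..hi} \<or> e + 1 \<in> {lo..hi}"
    have "y e = g (e + 1 - lo)" by (rule yg) (use e lo in auto)
    moreover have "y (e + 1) = g (e + 1 + 1 - lo)" by (rule yg) (use e lo in auto)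
    moreover have "e + 1 + 1 - lo = Suc (e + 1 - lo)" using e(2) by auto
    moreover have "e + 1 - lo < k" using e(2) lo by (auto simp: k_def)
    ultimately show "(y e, y (e + 1)) \<in> E" using g(3) by simp
  qed
  then show ?thesis by blast
qed

end


section \<open>Blocks\<close>

text \<open>The blocks are the windows of \<open>m\<close> consecutive integers that meet
  \<open>{1..n}\<close>, cut down to it; an index \<open>k > n\<close> stands for the window
  starting at \<open>n + 1 - k\<close>. Each site lies in exactly \<open>m\<close> windows.\<close>

lemma block_cover:
  assumes m: "1 \<le> m" and i: "i \<in> {1..n}"
  shows "card {k \<in> {1..n + m - 1}. i \<in> block n m k} = m"
proof (cases "m \<le> i")
  case True
  then have "{k \<in> {1..n + m - 1}. i \<in> block n m k} = {i + 1 - m..i}"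
    using m i by (auto simp: block_def split: if_splits)
  then show ?thesis using True by simp
next
  case False
  then have "{k \<in> {1..n + m - 1}. i \<in> block n m k} = {1..i} \<union> {n + 1..n + m - i}"
    using m i by (auto simp: block_def split: if_splits)
  also have "card \<dots> = card {1..i} + card {n + 1..n + m - i}"
    using i by (intro card_Un_disjoint) auto
  finally show ?thesis using False by simp
qed

lemma card_block_le:
  assumes "1 \<le> m" "k \<in> {1..n + m - 1}"
  shows "card (block n m k) \<le> m"
proof (cases "k \<le> n")
  case True
  then show ?thesis using assms by (auto simp: block_def)
next
  case False
  have "card (block n m k) \<le> card {1..n + m - k}"
    unfolding block_def using False by (intro card_mono) auto
  then show ?thesis using False by simp
qed

lemma block_interval:
  assumes "1 \<le> m" "k \<in> {1..n + m - 1}" "1 \<le> n"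
  obtains lo hi where "block n m k = {lo..hi}" "1 \<le> lo" "lo \<le> hi" "hi \<le> n"
    "lo = 1 \<or> hi = n \<or> m \<le> hi + 1 - lo"
proof (cases "k \<le> n")
  case True
  then have "k \<le> min (k + m - 1) n" "block n m k = {k..min (k + m - 1) n}"
    using assms by (auto simp: block_def)
  moreover have "min (k + m - 1) n = n \<or> m \<le> min (k + m - 1) n + 1 - k"
    using assms(1) by (cases "k + m - 1 \<le> n") auto
  ultimately show ?thesis using that[of k "min (k + m - 1) n"] assms by auto
next
  case False
  have "block n m k = {1..min (n + m - k) n}" using False by (auto simp: block_def)
  then show ?thesis using that[of 1 "min (n + m - k) n"] assms by auto
qed

text \<open>Only the window starting at \<open>i + 1\<close> and the one ending at
  \<open>i - 1\<close> can be adjacent. The latter starts at \<open>i - m\<close>; if this is not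
  positive, its index is \<open>n + m + 1 - i\<close>.\<close>

lemma card_adjacent_blocks:
  assumes "1 \<le> m" "i \<in> {1..n}"
  shows "card {k \<in> {1..n + m - 1}. i \<notin> block n m k \<and> (\<exists>j\<in>block n m k. j = i + 1 \<or> j + 1 = i)} \<le> 2"
proof -
  have "{k \<in> {1..n + m - 1}. i \<notin> block n m k \<and> (\<exists>j\<in>block n m k. j = i + 1 \<or> j + 1 = i)}
      \<subseteq> {i + 1, if m < i then i - m else n + m + 1 - i}"
    using assms by (auto simp: block_def split: if_splits)
  then have "card {k \<in> {1..n + m - 1}. i \<notin> block n m k \<and> (\<exists>j\<in>block n m k. j = i + 1 \<or> j + 1 = i)}
      \<le> card {i + 1, if m < i then i - m else n + m + 1 - i}"
    by (intro card_mono) auto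
  also have "\<dots> \<le> 2" by (simp add: card_insert_if)
  finally show ?thesis .
qed


section \<open>Contraction\<close>

context path_dynamics
begin

lemma m_pos: "1 \<le> m"
  using l_pos l_le_m by simp

definition blocks :: "nat set" where
  "blocks = {1..n + m - 1}"

definition kernel :: "(nat \<Rightarrow> 'c) \<Rightarrow> (nat \<Rightarrow> 'c) pmf" where
  "kernel = random_update n C E Om blocks (block n m)"

text \<open>Average over the blocks of the factor for a single disagreement: 0 for the
  \<open>m\<close> blocks containing it, 1 for the others, and an extra \<open>K\<close> for at most
  two adjacent ones.\<close>

definition \<rho> :: real where
  "\<rho> = (real (card blocks) - real m + 2 * K) / real (card blocks)"

lemma blocks: "finite blocks" "blocks \<noteq> {}" "0 < card blocks" "m \<le> card blocks"
  using m_pos n_pos by (auto simp: blocks_def)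

lemma \<rho>_nonneg: "0 \<le> \<rho>"
  unfolding \<rho>_def using blocks K_nonneg by (intro divide_nonneg_nonneg) auto

lemma block_moves_nonempty:
  assumes "x \<in> Om" "k \<in> blocks"
  shows "moves (block n m k) x \<noteq> {}"
  using block_interval[OF m_pos assms(2)[unfolded blocks_def] n_pos] moves_nonempty[OF assms(1)]
  by metis

lemma set_heat_bath:
  assumes "x \<in> Om" "k \<in> blocks"
  shows "set_pmf (heat_bath n C E Om (block n m k) x) \<subseteq> Om"
  using set_pmf_of_set[OF block_moves_nonempty[OF assms] finite_moves]
  by (auto simp: heat_bath_def moves_def)

lemma set_kernel:
  assumes "x \<in> Om"
  shows "set_pmf (kernel x) \<subseteq> Om"
  using set_heat_bath[OF assms] blocks by (auto simp: kernel_def random_update_def)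

lemma expectation_kernel:
  assumes "x \<in> Om"
  shows "measure_pmf.expectation (kernel x) f = mean blocks (\<lambda>k. mean (moves (block n m k) x) f)"
proof -
  have "measure_pmf.expectation (kernel x) f =
    (\<Sum>k\<in>blocks. measure_pmf.expectation (heat_bath n C E Om (block n m k) x) f /\<^sub>R real (card blocks))"
    unfolding kernel_def random_update_def
    using finite_subset[OF set_heat_bath[OF assms] finite_Om] blocks
    by (intro pmf_expectation_bind_pmf_of_set) auto
  also have "\<dots> = (\<Sum>k\<in>blocks. mean (moves (block n m k) x) f / real (card blocks))"
  proof (rule sum.cong)
    fix k assume k: "k \<in> blocks"
    show "measure_pmf.expectation (heat_bath n C E Om (block n m k) x) f /\<^sub>R real (card blocks) =
      mean (moves (block n m k) x) f / real (card blocks)"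
      using integral_pmf_of_set[OF block_moves_nonempty[OF assms k] finite_moves, of f]
      by (simp add: heat_bath_def moves_def mean_def field_simps)
  qed simp
  finally show ?thesis by (simp add: mean_def sum_divide_distrib)
qed

section \<open>A single disagreement inside, far from or beside a block\<close>

lemma moves_cong_inside:
  assumes "i \<in> \<Lambda>" "\<And>j. j \<noteq> i \<Longrightarrow> x j = y j"
  shows "moves \<Lambda> x = moves \<Lambda> y"
proof -
  have "(\<forall>j\<in>{1..n} - \<Lambda>. z j = x j) \<longleftrightarrow> (\<forall>j\<in>{1..n} - \<Lambda>. z j = y j)" for z
    using assms by (metis DiffE)
  then show ?thesis unfolding set_eq_iff moves_iff by blast
qed

lemma fun_upd_moves:
  assumes y: "y \<in> Om" and i: "i \<in> {1..n}" "i \<notin> \<Lambda>"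
    and far: "\<And>j. j \<in> \<Lambda> \<Longrightarrow> j \<noteq> i + 1 \<and> j + 1 \<noteq> i"
    and agree: "\<And>j. j \<noteq> i \<Longrightarrow> x j = y j" and z: "z \<in> moves \<Lambda> x"
  shows "z(i := y i) \<in> moves \<Lambda> y"
  unfolding moves_iff
proof (intro conjI ballI impI)
  show "z(i := y i) \<in> Om" using z y i by (auto simp: moves_iff Om_def PiE_def extensional_def Pi_def)
  show "(z(i := y i)) j = y j" if "j \<in> {1..n} - \<Lambda>" for j
    using z agree[of j] that by (auto simp: moves_iff)
  fix e assume e: "e \<in> {1..<n}" "e \<in> \<Lambda> \<or> e + 1 \<in> \<Lambda>"
  then have "e \<noteq> i" "e + 1 \<noteq> i" using far[of e] far[of "e + 1"] i(2) by auto
  moreover have "(z e, z (e + 1)) \<in> E" using z e unfolding moves_iff by blast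
  ultimately show "((z(i := y i)) e, (z(i := y i)) (e + 1)) \<in> E" by simp
qed

text \<open>No constraint of the block involves site \<open>i\<close>, so the same update is
  possible on both sides and the disagreement at \<open>i\<close> merely survives.\<close>

lemma mean_moves_far:
  assumes x: "x \<in> Om" and y: "y \<in> Om" and i: "i \<in> {1..n}" "i \<notin> \<Lambda>"
    and far: "\<And>j. j \<in> \<Lambda> \<Longrightarrow> j \<noteq> i + 1 \<and> j + 1 \<noteq> i"
    and agree: "\<And>j. j \<noteq> i \<Longrightarrow> x j = y j"
    and ne: "moves \<Lambda> x \<noteq> {}" and f: "Lip d f" and d: "0 \<le> d"
  shows "\<bar>mean (moves \<Lambda> x) f - mean (moves \<Lambda> y) f\<bar> \<le> d"
proof -
  have zi: "z i = x i" if "z \<in> moves \<Lambda> x" for z x using that i by (auto simp: moves_iff)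
  have xy: "z(i := y i) \<in> moves \<Lambda> y" if "z \<in> moves \<Lambda> x" for z
    by (rule fun_upd_moves[OF y i _ _ that]) (use far agree in auto)
  have yx: "z(i := x i) \<in> moves \<Lambda> x" if "z \<in> moves \<Lambda> y" for z
    by (rule fun_upd_moves[OF x i _ _ that]) (use far agree in auto)
  have "bij_betw (\<lambda>z. z(i := y i)) (moves \<Lambda> x) (moves \<Lambda> y)"
  proof (rule bij_betw_byWitness[where f' = "\<lambda>z. z(i := x i)"])
    show "\<forall>z\<in>moves \<Lambda> x. z(i := y i, i := x i) = z" using zi[of _ x] by auto
    show "\<forall>z\<in>moves \<Lambda> y. z(i := x i, i := y i) = z" using zi[of _ y] by auto
    show "(\<lambda>z. z(i := y i)) ` moves \<Lambda> x \<subseteq> moves \<Lambda> y" using xy by blast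
    show "(\<lambda>z. z(i := x i)) ` moves \<Lambda> y \<subseteq> moves \<Lambda> x" using yx by blast
  qed
  then have eq: "mean (moves \<Lambda> y) f = mean (moves \<Lambda> x) (\<lambda>z. f (z(i := y i)))" by (rule mean_bij)
  show ?thesis unfolding eq
  proof (rule mean_diff_le_same[OF finite_moves ne])
    fix z assume z: "z \<in> moves \<Lambda> x"
    have "z \<in> Om" "z(i := y i) \<in> Om" using z xy[OF z] by (auto simp: moves_iff)
    then have "\<bar>f z - f (z(i := y i))\<bar> \<le> d * real (hamming n z (z(i := y i)))"
      using f by (simp add: Lip_def)
    also have "hamming n z (z(i := y i)) \<le> card {i}"
      unfolding hamming_def by (intro card_mono) auto
    then have "d * real (hamming n z (z(i := y i))) \<le> d * 1" using d by (intro mult_left_mono) auto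
    finally show "\<bar>f z - f (z(i := y i))\<bar> \<le> d" by simp
  qed
qed

lemma mean_moves_adjacent:
  assumes x: "x \<in> Om" and y: "y \<in> Om" and i: "i \<in> {1..n}"
    and lo: "1 \<le> lo" "lo \<le> hi" "hi \<le> n"
    and adj: "lo = i + 1 \<or> hi + 1 = i"
    and agree: "\<And>j. j \<noteq> i \<Longrightarrow> x j = y j"
    and ne: "moves {lo..hi} x \<noteq> {}" "moves {lo..hi} y \<noteq> {}"
    and f: "Lip d f" and d: "0 \<le> d"
  shows "\<bar>mean (moves {lo..hi} x) f - mean (moves {lo..hi} y) f\<bar> \<le> d * (1 + K)"
  using adj
proof
  assume lo_eq: "lo = i + 1"
  have r: "1 \<le> i" "i < hi" using lo_eq lo i by auto
  let ?js = "[i + 1..<hi + 1]"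
  have js: "set ?js = {lo..hi}" "length ?js = hi - i" using lo_eq by auto
  define F where "F = (if hi < n then {c. (c, x (hi + 1)) \<in> E} else UNIV)"
  have F: "F = (if hi < n then {c. (c, y (hi + 1)) \<in> E} else UNIV)"
    using agree[of "hi + 1"] r by (simp add: F_def)
  have "bij_betw (\<lambda>z. map z ?js) (moves (set ?js) x) (walks E F (length ?js) (x i))"
    using moves_bij_walks_right[OF x r lo(3)] unfolding js F_def lo_eq .
  moreover have "bij_betw (\<lambda>z. map z ?js) (moves (set ?js) y) (walks E F (length ?js) (y i))"
    using moves_bij_walks_right[OF y r lo(3)] unfolding js F lo_eq .
  ultimately show ?thesis
    using mean_moves_percolation[OF x y i agree distinct_upt[of "i + 1" "hi + 1"] _ _ _ _ f d] ne unfolding js by blast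
next
  assume hi_eq: "hi + 1 = i"
  have r: "1 \<le> lo" "lo < i" "i \<le> n" using hi_eq lo i by auto
  let ?js = "rev [lo..<i]"
  have js: "set ?js = {lo..hi}" "length ?js = i - lo" "{lo..<i} = {lo..hi}" using hi_eq by auto
  define F where "F = (if 1 < lo then {c. (c, x (lo - 1)) \<in> E} else UNIV)"
  have F: "F = (if 1 < lo then {c. (c, y (lo - 1)) \<in> E} else UNIV)"
    using agree[of "lo - 1"] r by (simp add: F_def)
  have "bij_betw (\<lambda>z. map z ?js) (moves (set ?js) x) (walks E F (length ?js) (x i))"
    using moves_bij_walks_left[OF x r] unfolding js F_def .
  moreover have "bij_betw (\<lambda>z. map z ?js) (moves (set ?js) y) (walks E F (length ?js) (y i))"
    using moves_bij_walks_left[OF y r] unfolding js F .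
  moreover have "distinct ?js" by simp
  ultimately show ?thesis
    using mean_moves_percolation[where js = ?js, OF x y i agree _ _ _ _ _ f d] ne unfolding js by blast
qed

lemma kernel_contraction_single:
  assumes x: "x \<in> Om" and y: "y \<in> Om" and i: "i \<in> {1..n}"
    and agree: "\<And>j. j \<noteq> i \<Longrightarrow> x j = y j" and f: "Lip d f" and d: "0 \<le> d"
  shows "\<bar>measure_pmf.expectation (kernel x) f - measure_pmf.expectation (kernel y) f\<bar> \<le> \<rho> * d"
proof -
  define near where
    "near = {k \<in> blocks. i \<notin> block n m k \<and> (\<exists>j\<in>block n m k. j = i + 1 \<or> j + 1 = i)}"
  define inside where "inside = {k \<in> blocks. i \<in> block n m k}"
  define g where "g k = mean (moves (block n m k) x) f - mean (moves (block n m k) y) f" for k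
  have near: "near \<subseteq> blocks" "card near \<le> 2"
    using card_adjacent_blocks[OF m_pos i] by (auto simp: near_def blocks_def)
  have inside: "inside \<subseteq> blocks" "card inside = m"
    using block_cover[OF m_pos i] by (auto simp: inside_def blocks_def)
  have g: "\<bar>g k\<bar> \<le> d * ((1 - (if k \<in> inside then 1 else 0)) + (if k \<in> near then K else 0))"
    if k: "k \<in> blocks" for k
  proof (cases "i \<in> block n m k")
    case True
    then have "g k = 0" using moves_cong_inside[OF True agree] by (simp add: g_def)
    then show ?thesis using True k d by (auto simp: inside_def near_def)
  next
    case False
    then have ni: "k \<notin> inside" by (simp add: inside_def)
    have ne: "moves (block n m k) x \<noteq> {}" "moves (block n m k) y \<noteq> {}"
      using block_moves_nonempty k x y by auto
    show ?thesis
    proof (cases "k \<in> near")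
      case True
      obtain lo hi where b: "block n m k = {lo..hi}" "1 \<le> lo" "lo \<le> hi" "hi \<le> n"
        using block_interval[OF m_pos k[unfolded blocks_def] n_pos] by metis
      have "lo = i + 1 \<or> hi + 1 = i" using True False by (auto simp: near_def b(1))
      then have "\<bar>g k\<bar> \<le> d * (1 + K)"
        using mean_moves_adjacent[OF x y i b(2-4) _ agree _ _ f d] ne unfolding g_def b(1) by blast
      then show ?thesis using True ni by simp
    next
      case not_near: False
      have "\<bar>g k\<bar> \<le> d" unfolding g_def
        by (rule mean_moves_far[OF x y i False _ agree ne(1) f d])
          (use not_near k False in \<open>auto simp: near_def\<close>)
      then show ?thesis using not_near ni by simp
    qed
  qed
  have "\<bar>measure_pmf.expectation (kernel x) f - measure_pmf.expectation (kernel y) f\<bar> =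
      \<bar>\<Sum>k\<in>blocks. g k\<bar> / real (card blocks)"
    unfolding expectation_kernel[OF x] expectation_kernel[OF y]
    by (simp add: mean_def g_def sum_subtractf flip: diff_divide_distrib)
  also have "\<bar>\<Sum>k\<in>blocks. g k\<bar> \<le>
      (\<Sum>k\<in>blocks. d * ((1 - (if k \<in> inside then 1 else 0)) + (if k \<in> near then K else 0)))"
    using g by (intro order.trans[OF sum_abs] sum_mono)
  also have "\<dots> = d * (real (card blocks) - real (card inside) + real (card near) * K)"
    using near inside blocks
    by (simp add: sum_distrib_left[symmetric] sum.distrib sum_subtractf sum.If_cases Int_absorb1)
  also have "real (card near) * K \<le> 2 * K"
    using near K_nonneg by (intro mult_right_mono) auto
  then have "d * (real (card blocks) - real (card inside) + real (card near) * K) \<le>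
      d * (real (card blocks) - real m + 2 * K)"
    using inside d by (intro mult_left_mono) auto
  finally show ?thesis
    by (simp add: \<rho>_def divide_right_mono mult.commute)
qed

text \<open>Telescoping along a path that copies \<open>y\<close> into \<open>x\<close> one site at
  a time. The intermediate configurations stay in \<open>Om\<close> because it is a product; among
  colourings this could fail.\<close>

lemma Lip_from_single:
  assumes single: "\<And>x y i. x \<in> Om \<Longrightarrow> y \<in> Om \<Longrightarrow> i \<in> {1..n} \<Longrightarrow> (\<And>j. j \<noteq> i \<Longrightarrow> x j = y j) \<Longrightarrow>
    \<bar>f x - f y\<bar> \<le> d"
  shows "Lip d f"
proof -
  have "\<bar>f x - f y\<bar> \<le> d * real h" if "x \<in> Om" "y \<in> Om" "hamming n x y = h" for x y h
    using that
  proof (induction h arbitrary: x)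
    case 0
    then have "x j = y j" if "j \<in> {1..n}" for j
      using that by (auto simp: hamming_def)
    then have "x = y" using 0 by (auto simp: Om_def PiE_def extensional_def fun_eq_iff) metis
    then show ?case by simp
  next
    case (Suc h)
    have "{j \<in> {1..n}. x j \<noteq> y j} \<noteq> {}" using Suc.prems(3) unfolding hamming_def by (metis card.empty nat.simps(3))
    then obtain i where i: "i \<in> {1..n}" "x i \<noteq> y i" by auto
    define x' where "x' = x(i := y i)"
    have x': "x' \<in> Om" using Suc.prems i by (auto simp: x'_def Om_def PiE_def extensional_def Pi_def)
    have "{j \<in> {1..n}. x' j \<noteq> y j} = {j \<in> {1..n}. x j \<noteq> y j} - {i}" by (auto simp: x'_def)
    then have "hamming n x' y = h" using Suc.prems(3) i by (simp add: hamming_def)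
    then have "\<bar>f x' - f y\<bar> \<le> d * real h" using Suc.IH x' Suc.prems by blast
    moreover have "\<bar>f x - f x'\<bar> \<le> d" by (rule single[OF Suc.prems(1) x' i(1)]) (simp add: x'_def)
    ultimately show ?case by (simp add: algebra_simps)
  qed
  then show ?thesis by (simp add: Lip_def)
qed

section \<open>Iterating the contraction\<close>

lemma set_chain: "x \<in> Om \<Longrightarrow> set_pmf (chain_distribution kernel t x) \<subseteq> Om"
  unfolding chain_distribution_def by (induction t) (use set_kernel in auto)

text \<open>\<open>chain_distribution\<close> adds steps at the end, so the last step is absorbed
  into the test function: \<open>f\<close> becomes its one-step expectation, with constant
  \<open>\<rho> * d\<close>. Hence the induction is over all \<open>f\<close> and
  \<open>d\<close>.\<close>

lemma Lip_chain:
  assumes "Lip d f" "0 \<le> d"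
  shows "Lip (\<rho> ^ t * d) (\<lambda>x. measure_pmf.expectation (chain_distribution kernel t x) f)"
  using assms
proof (induction t arbitrary: d f)
  case 0
  then show ?case by (simp add: chain_distribution_def)
next
  case (Suc t)
  define g where "g z = measure_pmf.expectation (kernel z) f" for z
  have "Lip (\<rho> * d) g" unfolding g_def
    by (rule Lip_from_single) (rule kernel_contraction_single[OF _ _ _ _ Suc.prems])
  then have IH: "Lip (\<rho> ^ t * (\<rho> * d)) (\<lambda>x. measure_pmf.expectation (chain_distribution kernel t x) g)"
    using Suc \<rho>_nonneg by simp
  have "measure_pmf.expectation (chain_distribution kernel (Suc t) x) f =
      measure_pmf.expectation (chain_distribution kernel t x) g" if x: "x \<in> Om" for x
  proof -
    have "measure_pmf.expectation (chain_distribution kernel t x \<bind> kernel) f =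
      (\<Sum>a\<in>Om. pmf (chain_distribution kernel t x) a *\<^sub>R g a)"
      unfolding g_def using set_kernel finite_Om set_chain[OF x]
      by (intro pmf_expectation_bind) (auto intro: finite_subset)
    also have "\<dots> = measure_pmf.expectation (chain_distribution kernel t x) g"
      using set_chain[OF x] by (intro integral_measure_pmf[symmetric] finite_Om) auto
    finally show ?thesis by (simp add: chain_distribution_def)
  qed
  then show ?case using IH by (simp add: Lip_def mult_ac)
qed

lemma chain_contraction:
  assumes f: "\<And>x y. \<bar>f x - f y\<bar> \<le> 1" and xy: "x \<in> Om" "y \<in> Om"
  shows "\<bar>measure_pmf.expectation (chain_distribution kernel t x) f -
    measure_pmf.expectation (chain_distribution kernel t y) f\<bar> \<le> \<rho> ^ t * real n"
proof -
  have "Lip 1 f"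
    by (rule Lip_from_single) (rule f)
  then have "\<bar>measure_pmf.expectation (chain_distribution kernel t x) f -
    measure_pmf.expectation (chain_distribution kernel t y) f\<bar> \<le> \<rho> ^ t * real (hamming n x y)"
    using Lip_chain[of 1 f t] xy by (simp add: Lip_def)
  also have "hamming n x y \<le> card {1..n}" unfolding hamming_def by (intro card_mono) auto
  then have "\<rho> ^ t * real (hamming n x y) \<le> \<rho> ^ t * real n"
    using \<rho>_nonneg by (intro mult_left_mono) auto
  finally show ?thesis .
qed

end


section \<open>Total variation distance\<close>

lemma chain_distribution_Suc:
  "chain_distribution P (Suc t) x = chain_distribution P t x \<bind> P"
  by (simp add: chain_distribution_def)

lemma set_chain_distribution:
  assumes "\<And>x. x \<in> S \<Longrightarrow> set_pmf (P x) \<subseteq> S" "x \<in> S"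
  shows "set_pmf (chain_distribution P t x) \<subseteq> S"
  by (induction t) (use assms in \<open>auto simp: chain_distribution_Suc chain_distribution_def [of _ 0]\<close>)

lemma chain_distribution_cong:
  assumes "\<And>x. x \<in> S \<Longrightarrow> P x = P' x" "\<And>x. x \<in> S \<Longrightarrow> set_pmf (P x) \<subseteq> S" "x \<in> S"
  shows "chain_distribution P t x = chain_distribution P' t x"
proof (induction t)
  case (Suc t)
  have "set_pmf (chain_distribution P t x) \<subseteq> S"
    by (rule set_chain_distribution) (use assms in auto)
  then have "chain_distribution P t x \<bind> P = chain_distribution P t x \<bind> P'"
    using assms(1) by (intro bind_pmf_cong) auto
  then show ?case unfolding chain_distribution_Suc Suc[symmetric] .
qed (simp add: chain_distribution_def)

lemma bind_chain_stationary:
  assumes "\<pi> \<bind> P = \<pi>"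
  shows "\<pi> \<bind> chain_distribution P t = \<pi>"
proof (induction t)
  case 0
  show ?case by (simp add: chain_distribution_def bind_return_pmf')
next
  case (Suc t)
  have "\<pi> \<bind> chain_distribution P (Suc t) = (\<pi> \<bind> chain_distribution P t) \<bind> P"
    by (simp add: chain_distribution_Suc[abs_def] bind_assoc_pmf)
  then show ?case using Suc assms by simp
qed

text \<open>By stationarity the uniform distribution is the average, over uniform starting states
  \<open>y\<close>, of the distributions at time \<open>t\<close>. Comparing pairs of starting
  states therefore suffices.\<close>

lemma tv_dist_chain_le:
  assumes S: "finite S" "x \<in> S" and P: "\<And>x. x \<in> S \<Longrightarrow> set_pmf (P x) \<subseteq> S"
    and stat: "pmf_of_set S \<bind> P = pmf_of_set S"
    and diff: "\<And>f y. (\<And>u v. \<bar>f u - f v\<bar> \<le> 1) \<Longrightarrow> y \<in> S \<Longrightarrow>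
      \<bar>measure_pmf.expectation (chain_distribution P t x) f -
       measure_pmf.expectation (chain_distribution P t y) f\<bar> \<le> \<delta>"
  shows "tv_dist S (chain_distribution P t x) (pmf_of_set S) \<le> \<delta>"
proof -
  have ne: "S \<noteq> {}" using S by auto
  define p where "p = chain_distribution P t x"
  \<comment> \<open>The test function attaining the total variation distance: the values 1/2 and
    -1/2 match the factor in \<open>tv_dist\<close> and keep the oscillation at most 1.\<close>
  define f :: "'a \<Rightarrow> real" where "f i = (if pmf (pmf_of_set S) i \<le> pmf p i then 1 / 2 else - 1 / 2)" for i
  define g where "g y = measure_pmf.expectation (chain_distribution P t y) f" for y
  have f: "\<bar>f u - f v\<bar> \<le> 1" for u v by (simp add: f_def)
  have set_chain: "set_pmf (chain_distribution P t y) \<subseteq> S" if "y \<in> S" for y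
    by (rule set_chain_distribution) (use P that in auto)
  have finite_chain: "finite (set_pmf (chain_distribution P t y))" if "y \<in> S" for y
    using set_chain[OF that] S(1) by (rule finite_subset)
  have exp: "measure_pmf.expectation r f = (\<Sum>i\<in>S. pmf r i * f i)" if "set_pmf r \<subseteq> S" for r
    using that integral_measure_pmf[OF S(1), of r f] by auto
  have "measure_pmf.expectation (pmf_of_set S) f =
      measure_pmf.expectation (pmf_of_set S \<bind> chain_distribution P t) f"
    by (simp add: bind_chain_stationary[OF stat])
  also have "\<dots> = (\<Sum>y\<in>S. g y /\<^sub>R real (card S))"
    unfolding g_def using S finite_chain ne by (intro pmf_expectation_bind_pmf_of_set) auto
  also have "\<dots> = mean S g" by (simp add: mean_def divide_inverse_commute flip: sum_distrib_left)
  finally have "measure_pmf.expectation (pmf_of_set S) f = mean S g" .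
  moreover have "tv_dist S p (pmf_of_set S) =
      measure_pmf.expectation p f - measure_pmf.expectation (pmf_of_set S) f"
  proof -
    have "set_pmf p \<subseteq> S" "set_pmf (pmf_of_set S) \<subseteq> S" using set_chain S ne by (auto simp: p_def)
    then show ?thesis
      unfolding tv_dist_def sum_distrib_left exp sum_subtractf[symmetric]
      by (auto simp: exp f_def field_simps sum_subtractf[symmetric] intro!: sum.cong)
  qed
  moreover have "\<bar>mean {x} g - mean S g\<bar> \<le> \<delta>"
    by (rule mean_diff_le) (use S ne diff[OF f] in \<open>auto simp: g_def\<close>)
  ultimately show ?thesis unfolding p_def by (simp add: mean_def g_def)
qed


section \<open>Stationarity of the uniform distribution\<close>

lemma block_colourings_refl:
  "x \<in> colourings n C E \<Longrightarrow> x \<in> block_colourings n C E \<Lambda> x"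
  by (auto simp: colourings_def block_colourings_def)

lemma block_colourings_eq:
  "y \<in> block_colourings n C E \<Lambda> x \<Longrightarrow> block_colourings n C E \<Lambda> y = block_colourings n C E \<Lambda> x"
  by (auto simp: block_colourings_def)

lemma finite_colourings: "finite C \<Longrightarrow> finite (colourings n C E)"
  by (simp add: colourings_def configurations_def finite_PiE)

lemma set_heat_bath_state:
  assumes "finite C" "S \<subseteq> colourings n C E" "x \<in> S"
  shows "set_pmf (heat_bath n C E S \<Lambda> x) = block_colourings n C E \<Lambda> x \<inter> S"
proof -
  have "block_colourings n C E \<Lambda> x \<inter> S \<noteq> {}" using assms block_colourings_refl by blast
  moreover have "finite S" using assms finite_colourings finite_subset by blast
  ultimately show ?thesis unfolding heat_bath_def by (intro set_pmf_of_set) auto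
qed

text \<open>On \<open>S\<close>, being an outcome of one another is an equivalence relation: two
  related states draw from the same set. On \<open>Om\<close> this breaks down, since an improper
  edge once removed never comes back.\<close>

lemma heat_bath_sym:
  assumes "finite C" "S \<subseteq> colourings n C E" "x \<in> S" "y \<in> S"
  shows "pmf (heat_bath n C E S \<Lambda> x) y = pmf (heat_bath n C E S \<Lambda> y) x"
proof (cases "y \<in> block_colourings n C E \<Lambda> x")
  case True
  let ?A = "block_colourings n C E \<Lambda> x \<inter> S"
  have "finite ?A" using assms finite_colourings finite_subset by blast
  moreover have "x \<in> ?A" "y \<in> ?A" using True assms block_colourings_refl by blast+
  moreover then have "?A \<noteq> {}" by blast
  ultimately show ?thesis
    unfolding heat_bath_def block_colourings_eq[OF True] by simp
next
  case False
  then have "x \<notin> block_colourings n C E \<Lambda> y"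
    using block_colourings_eq block_colourings_refl assms by blast
  then have "x \<notin> set_pmf (heat_bath n C E S \<Lambda> y)" "y \<notin> set_pmf (heat_bath n C E S \<Lambda> x)"
    using False set_heat_bath_state[OF assms(1,2)] assms(3,4) by auto
  then show ?thesis by (simp add: set_pmf_iff)
qed

lemma set_random_update:
  assumes "finite C" "S \<subseteq> colourings n C E" "x \<in> S"
  shows "set_pmf (random_update n C E S I \<Theta> x) \<subseteq> S"
  using set_heat_bath_state[OF assms] by (auto simp: random_update_def)

text \<open>Symmetric transition probabilities make the column sums over \<open>S\<close> equal to
  the row sums, which are 1.\<close>

lemma random_update_stationary:
  assumes C: "finite C" and S: "S \<subseteq> colourings n C E" "S \<noteq> {}"
  shows "pmf_of_set S \<bind> random_update n C E S I \<Theta> = pmf_of_set S"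
proof (rule pmf_eqI)
  fix y
  let ?P = "random_update n C E S I \<Theta>"
  have fin: "finite S" using C S finite_colourings finite_subset by blast
  have sym: "pmf (?P x) y = pmf (?P y) x" if "x \<in> S" "y \<in> S" for x
    using heat_bath_sym[OF C S(1) that] by (simp add: random_update_def pmf_bind)
  have eq: "pmf (pmf_of_set S \<bind> ?P) y = (\<Sum>x\<in>S. pmf (?P x) y) / real (card S)"
    using fin S by (simp add: pmf_bind integral_pmf_of_set)
  show "pmf (pmf_of_set S \<bind> ?P) y = pmf (pmf_of_set S) y"
  proof (cases "y \<in> S")
    case True
    have "(\<Sum>x\<in>S. pmf (?P x) y) = (\<Sum>x\<in>S. pmf (?P y) x)" using sym True by (intro sum.cong) auto
    also have "\<dots> = 1" by (rule sum_pmf_eq_1[OF fin set_random_update[OF C S(1) True]])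
    finally show ?thesis unfolding eq using True fin S by simp
  next
    case False
    then have "pmf (?P x) y = 0" if "x \<in> S" for x
      using set_random_update[OF C S(1) that] by (auto simp: pmf_eq_0_set_pmf)
    then show ?thesis unfolding eq using False fin S by simp
  qed
qed

section \<open>The true chain as a restriction of the enlarged one\<close>

context path_dynamics
begin

text \<open>An edge meeting the block is made proper by the update, and any other edge is inherited
  from \<open>x\<close>; so the outcomes of a colouring are colourings, and on \<open>S\<close> the
  two kernels agree.\<close>

lemma state_moves:
  assumes S: "S = {x \<in> colourings n C E. x 1 \<in> D 1}" and x: "x \<in> S"
  shows "block_colourings n C E \<Lambda> x \<inter> S = moves \<Lambda> x" and "x \<in> Om"
proof -
  have sub: "y \<in> Om" if y: "y \<in> S" for y
    unfolding Om_def
  proof (rule PiE_I)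
    fix j assume j: "j \<in> {1..n}"
    have "Suc k \<le> n \<Longrightarrow> y (Suc k) \<in> D (Suc k)" for k
    proof (induction k)
      case 0
      show ?case using y S by simp
    next
      case (Suc k)
      then have "(y (Suc k), y (Suc k + 1)) \<in> E" using y S by (auto simp: colourings_def)
      then show ?case using D_step[of "y (Suc k)" "Suc k"] Suc by simp
    qed
    from this[of "j - 1"] show "y j \<in> D j" using j by simp
  next
    fix j assume "j \<notin> {1..n}"
    then show "y j = undefined" using y S by (auto simp: colourings_def configurations_def)
  qed
  show "x \<in> Om" using sub x .
  show "block_colourings n C E \<Lambda> x \<inter> S = moves \<Lambda> x"
  proof (intro equalityI subsetI)
    fix y assume "y \<in> block_colourings n C E \<Lambda> x \<inter> S"
    then show "y \<in> moves \<Lambda> x" using sub by (auto simp: moves_def)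
  next
    fix y assume y: "y \<in> moves \<Lambda> x"
    have "(y e, y (e + 1)) \<in> E" if e: "e \<in> {1..<n}" for e
    proof (cases "e \<in> \<Lambda> \<or> e + 1 \<in> \<Lambda>")
      case True
      then show ?thesis using y e unfolding moves_iff by blast
    next
      case False
      then have "y e = x e" "y (e + 1) = x (e + 1)" using y e unfolding moves_iff by auto
      then show ?thesis using x S e by (auto simp: colourings_def)
    qed
    moreover have "y \<in> configurations n C" using y by (auto simp: moves_def block_colourings_def)
    moreover have "y 1 \<in> D 1" using y n_pos by (auto simp: moves_iff Om_def)
    ultimately show "y \<in> block_colourings n C E \<Lambda> x \<inter> S"
      using y S by (auto simp: moves_def colourings_def)
  qed
qed

lemma tv_dist_contraction:
  assumes S: "S = {x \<in> colourings n C E. x 1 \<in> D 1}" and x: "x \<in> S"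
  shows "tv_dist S (chain_distribution (random_update n C E S {1..n + m - 1} (block n m)) t x)
      (pmf_of_set S) \<le> \<rho> ^ t * real n"
proof -
  let ?P = "random_update n C E S {1..n + m - 1} (block n m)"
  have sub: "S \<subseteq> colourings n C E" using S by auto
  have fin: "finite S" using sub finite_colourings[OF finite_C] finite_subset by blast
  have P: "?P y = kernel y" if "y \<in> S" for y
    using state_moves(1)[OF S that]
    by (simp add: kernel_def random_update_def heat_bath_def moves_def blocks_def)
  note set_P = set_random_update[OF finite_C sub]
  have chain: "chain_distribution ?P t y = chain_distribution kernel t y" if "y \<in> S" for y
    by (rule chain_distribution_cong[where S = S], erule P, erule set_P, rule that)
  show ?thesis
  proof (rule tv_dist_chain_le[OF fin x])
    show "set_pmf (?P y) \<subseteq> S" if "y \<in> S" for y using set_P that by auto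
    show "pmf_of_set S \<bind> ?P = pmf_of_set S"
      by (rule random_update_stationary[OF finite_C sub]) (use x in auto)
    fix f :: "(nat \<Rightarrow> 'c) \<Rightarrow> real" and y
    assume "\<And>u v. \<bar>f u - f v\<bar> \<le> 1" "y \<in> S"
    then show "\<bar>measure_pmf.expectation (chain_distribution ?P t x) f -
        measure_pmf.expectation (chain_distribution ?P t y) f\<bar> \<le> \<rho> ^ t * real n"
      using chain_contraction[of f x y t] state_moves(2)[OF S] x chain by simp
  qed
qed

end


section \<open>Mixing time\<close>

lemma mixing_time_le:
  assumes "\<And>x. x \<in> S \<Longrightarrow> tv_dist S (chain_distribution P t x) \<pi> \<le> \<epsilon>" "0 < t"
  shows "mixing_time S P \<pi> \<epsilon> \<le> enat t"
  unfolding mixing_time_def using assms by (intro SUP_least INF_lower) auto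

text \<open>Rounding down the number of steps at most halves it, which is paid for by a contraction rate
  of \<^term>\<open>2 * s / N\<close> in place of \<^term>\<open>s / N\<close>.\<close>

lemma power_floor_le:
  fixes r s N M \<epsilon> :: real
  assumes r: "0 \<le> r" "r \<le> 1 - 2 * s / N" and pos: "0 < s" "0 < N" "0 < M" "0 < \<epsilon>"
    and T: "1 \<le> N * ln (M * inverse \<epsilon>) / s"
  shows "r ^ nat \<lfloor>N * ln (M * inverse \<epsilon>) / s\<rfloor> * M \<le> \<epsilon>"
proof -
  define T where "T = N * ln (M * inverse \<epsilon>) / s"
  define t where "t = nat \<lfloor>T\<rfloor>"
  have "1 \<le> \<lfloor>T\<rfloor>" using T by (simp add: T_def)
  then have t: "1 \<le> real t" "T - 1 < real t" unfolding t_def by linarith+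
  then have half: "T \<le> 2 * real t" by linarith
  have "r \<le> exp (- (2 * s / N))" using r(2) exp_ge_add_one_self[of "- (2 * s / N)"] by linarith
  then have "r ^ t \<le> exp (- (2 * s / N)) ^ t" using r(1) by (intro power_mono)
  also have "\<dots> = exp (- (s / N * (2 * real t)))" by (simp add: exp_of_nat_mult[symmetric] mult_ac)
  also have "\<dots> \<le> exp (- (s / N * T))" using half pos by (simp add: divide_right_mono)
  also have "s / N * T = ln (M * inverse \<epsilon>)" using pos by (simp add: T_def)
  also have "exp (- ln (M * inverse \<epsilon>)) = \<epsilon> / M" using pos by (simp add: exp_minus divide_simps)
  finally have "r ^ t * M \<le> \<epsilon>" using pos by (simp add: field_simps)
  then show ?thesis unfolding t_def T_def .
qed

lemma bigo_mixing_bound: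
  fixes a c s \<epsilon> :: real
  assumes "0 < \<epsilon>"
  shows "(\<lambda>m::nat. a * ((real m + c) * ln (real m * inverse \<epsilon>) / s)) \<in> O(\<lambda>m. real m * ln (real m))"
proof -
  have i: "0 < inverse \<epsilon>" using assms by simp
  have "(\<lambda>m::nat. real m + c) \<in> O(\<lambda>m. real m)" by real_asymp
  moreover have "(\<lambda>m::nat. ln (real m * inverse \<epsilon>)) \<in> O(\<lambda>m. ln (real m))" using i by real_asymp
  ultimately have "(\<lambda>m::nat. (real m + c) * ln (real m * inverse \<epsilon>)) \<in> O(\<lambda>m. real m * ln (real m))"
    by (rule landau_o.big.mult)
  then have "(\<lambda>m::nat. (a / s) * ((real m + c) * ln (real m * inverse \<epsilon>)))
      \<in> O(\<lambda>m. 1 * (real m * ln (real m)))"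
    by (rule landau_o.big.mult[rotated]) simp
  then show ?thesis by (simp add: field_simps)
qed

lemma state_space_subset: "is_state_space n C E S \<Longrightarrow> S \<subseteq> colourings n C E"
  by (auto simp: is_state_space_def split: if_splits)

text \<open>A single colour is treated apart: without a loop it has no neighbour, and the numerical
  margin of the general case relies on two colours. Here there is only one state.\<close>

lemma tv_dist_singleton_colour:
  assumes C: "card C = 1" and S: "S \<subseteq> colourings n C E" and x: "x \<in> S"
  shows "tv_dist S (chain_distribution (random_update n C E S I \<Theta>) t x) (pmf_of_set S) \<le> 0"
proof -
  obtain c where c: "C = {c}" using C by (auto simp: card_1_singleton_iff)
  have one: "y = x" if "y \<in> S" for y
  proof
    fix i
    have "y \<in> {1..n} \<rightarrow>\<^sub>E {c}" "x \<in> {1..n} \<rightarrow>\<^sub>E {c}"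
      using that x S by (auto simp: colourings_def configurations_def c)
    then show "y i = x i" by (cases "i \<in> {1..n}") (auto dest: PiE_mem PiE_arb)
  qed
  have fin: "finite C" by (simp add: c)
  show ?thesis
  proof (rule tv_dist_chain_le[OF finite_subset[OF S finite_colourings[OF fin]] x])
    show "pmf_of_set S \<bind> random_update n C E S I \<Theta> = pmf_of_set S"
      by (rule random_update_stationary[OF fin S]) (use x in auto)
  qed (use one set_random_update[OF fin S] in auto)
qed

lemma tv_dist_random_update:
  assumes conn: "connected_graph C E" and q: "q = card C" and s: "s = 4 * q + 1"
    and \<gamma>: "\<gamma> = 2 * q ^ s + 1" and n: "1 \<le> n" and S: "is_state_space n C E S" and x: "x \<in> S"
  defines "N \<equiv> real n + 2 * real s * real q ^ s + real s - 1"
  shows "\<exists>r. 0 \<le> r \<and> r \<le> 1 - 2 * real s / N \<and>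
    tv_dist S (chain_distribution (random_update n C E S {1..n + s * \<gamma> - 1} (block n (s * \<gamma>))) t x)
      (pmf_of_set S) \<le> r ^ t * real n"
proof -
  have C: "finite C" "C \<noteq> {}" and E: "E \<subseteq> C \<times> C" "sym E"
    using conn by (auto simp: connected_graph_def graph_def)
  then have q1: "1 \<le> q" unfolding q by (simp add: Suc_leI card_gt_0_iff)
  have Nge: "2 * real s \<le> N"
  proof -
    have "real s * 1 \<le> real s * real q ^ s" using q1 by (intro mult_left_mono) auto
    then show ?thesis using n unfolding N_def by simp
  qed
  have Npos: "0 < N" using Nge s by simp
  show ?thesis
  proof (cases "q = 1")
    case True
    have "0 \<le> (1 - 2 * real s / N) ^ t * real n"
      using Nge Npos by (intro mult_nonneg_nonneg zero_le_power) (auto simp: field_simps)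
    with tv_dist_singleton_colour[OF True[unfolded q] state_space_subset[OF S] x]
    have "tv_dist S (chain_distribution (random_update n C E S {1..n + s * \<gamma> - 1} (block n (s * \<gamma>))) t x)
      (pmf_of_set S) \<le> (1 - 2 * real s / N) ^ t * real n"
      by (rule order.trans)
    moreover have "0 \<le> 1 - 2 * real s / N" using Nge Npos by (simp add: field_simps)
    ultimately show ?thesis by blast
  next
    case False
    then have q2: "2 \<le> q" using q1 by simp
    obtain D :: "nat \<Rightarrow> 'a set" where D: "\<And>i. D i \<subseteq> C \<and> D (i + 2) = D i"
      "\<And>i u v. u \<in> D i \<Longrightarrow> (u, v) \<in> E \<Longrightarrow> v \<in> D (i + 1)"
      "\<And>i u v. u \<in> D i \<Longrightarrow> v \<in> D i \<Longrightarrow> (u, v) \<in> E ^^ (4 * card C)"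
      "S = {x \<in> colourings n C E. x 1 \<in> D 1}"
      using parity_classes[OF conn q2[unfolded q] S n] by blast
    define l where "l = 4 * q"
    have ls: "s = l + 1" by (simp add: s l_def)
    have le: "l \<le> s * \<gamma>" using \<gamma> by (simp add: ls)
    interpret path_dynamics n "s * \<gamma>" l C E D
      by unfold_locales
        (use C E D connected_graph_neighbour[OF conn q2[unfolded q]] q1 n le in
          \<open>auto simp: l_def q[symmetric]\<close>)
    have card: "real (card blocks) = N"
    proof -
      have "1 \<le> s * \<gamma>" using \<gamma> s by simp
      then have "real (card blocks) = real n + real (s * \<gamma>) - 1"
        using n by (simp add: blocks_def of_nat_diff del: of_nat_mult)
      then show ?thesis by (simp add: N_def \<gamma> algebra_simps)
    qed
    \<comment> \<open>Both \<open>2 * s\<close> and \<open>2 * K\<close> are at most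
      \<open>2 * s * Q\<close>, which is at most \<open>s * q ^ s\<close> because
      \<open>q \<ge> 2\<close>; the factor 2 in \<open>\<gamma>\<close> makes room for both.\<close>
    have "2 * real s + 2 * K \<le> real (s * \<gamma>)"
    proof -
      define Q where "Q = real q ^ l"
      have Q: "1 \<le> Q" unfolding Q_def using q1 by (intro one_le_power) simp
      have "K \<le> real s * Q" using Q by (simp add: K_def Q_def q ls algebra_simps)
      moreover have "real s * (2 * Q) \<le> real s * real q ^ s"
        using q2 Q by (intro mult_left_mono) (auto simp: ls Q_def intro: mult_right_mono)
      moreover have "real s * 1 \<le> real s * Q" using Q by (intro mult_left_mono) auto
      ultimately show ?thesis by (simp add: \<gamma> algebra_simps)
    qed
    then have "2 * real s / N \<le> (real (s * \<gamma>) - 2 * K) / N"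
      using Npos by (intro divide_right_mono) auto
    moreover have "\<rho> = 1 - (real (s * \<gamma>) - 2 * K) / N"
      unfolding \<rho>_def card using Npos by (simp add: divide_simps del: of_nat_mult)
    ultimately have "\<rho> \<le> 1 - 2 * real s / N" by linarith
    then show ?thesis using \<rho>_nonneg tv_dist_contraction[OF D(4) x] by blast
  qed
qed

text \<open>The mixing time of a nonempty state space is at least 1, as only \<open>t > 0\<close>
  counts, so the bound must be at least 1 to be meaningful; the last hypothesis secures this. The
  factor \<open>s * \<gamma>\<close> in the asymptotic claim converts block-updates into updates of
  sites.\<close>

theorem theorem6:
  fixes C :: "'c set" and E :: "('c \<times> 'c) set" and S :: "(nat \<Rightarrow> 'c) set"
    and q s \<gamma> n :: nat and \<epsilon> :: real
  assumes "connected_graph C E"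
    and "q = card C"
    and "s = 4 * q + 1"
    and "\<gamma> = 2 * q ^ s + 1"
    and "n \<ge> 1"
    and "is_state_space n C E S"
    and "\<epsilon> > 0"
    and "n \<ge> 2 \<and> \<epsilon> < 1
         \<or> 1 \<le> (real n + 2 * real s * real q ^ s + real s - 1) * ln (real n * inverse \<epsilon>) / real s"
  shows "(\<forall>i\<in>{1..n}. card {k \<in> {1..n + s * \<gamma> - 1}. i \<in> block n (s * \<gamma>) k} = s * \<gamma>) \<and>
         (\<forall>k\<in>{1..n + s * \<gamma> - 1}. card (block n (s * \<gamma>) k) \<le> s * \<gamma>) \<and>
         ereal_of_enat
           (mixing_time S (random_update n C E S {1..n + s * \<gamma> - 1} (block n (s * \<gamma>)))
              (pmf_of_set S) \<epsilon>)
         \<le> ereal ((real n + 2 * real s * real q ^ s + real s - 1) * ln (real n * inverse \<epsilon>) / real s) \<and>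
         (\<lambda>m::nat. real (s * \<gamma>) *
            ((real m + 2 * real s * real q ^ s + real s - 1) * ln (real m * inverse \<epsilon>) / real s))
         \<in> O(\<lambda>m. real m * ln (real m))"
proof (intro conjI ballI)
  have m: "1 \<le> s * \<gamma>" using assms(3,4) by simp
  show "card {k \<in> {1..n + s * \<gamma> - 1}. i \<in> block n (s * \<gamma>) k} = s * \<gamma>" if "i \<in> {1..n}" for i
    using block_cover[OF m that] .
  show "card (block n (s * \<gamma>) k) \<le> s * \<gamma>" if "k \<in> {1..n + s * \<gamma> - 1}" for k
    using card_block_le[OF m that] .
  show "(\<lambda>m::nat. real (s * \<gamma>) *
      ((real m + 2 * real s * real q ^ s + real s - 1) * ln (real m * inverse \<epsilon>) / real s))
    \<in> O(\<lambda>m. real m * ln (real m))"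
    using bigo_mixing_bound[OF assms(7), of "real (s * \<gamma>)" "2 * real s * real q ^ s + real s - 1" "real s"]
    by (simp add: add.assoc add_diff_eq)
  define N where "N = real n + 2 * real s * real q ^ s + real s - 1"
  define T where "T = N * ln (real n * inverse \<epsilon>) / real s"
  have "0 < card C" using assms(1) by (auto simp: connected_graph_def graph_def card_gt_0_iff)
  then have q1: "1 \<le> q" using assms(2) by simp
  have s0: "0 < real s" using assms(3) by simp
  have Nge: "3 * real s \<le> N"
  proof -
    have "real s * 1 \<le> real s * real q ^ s" using q1 by (intro mult_left_mono) auto
    then show ?thesis using assms(5) unfolding N_def by simp
  qed
  have T1: "1 \<le> T"
    using assms(8)
  proof
    assume n: "n \<ge> 2 \<and> \<epsilon> < 1"
    have "2 \<le> real n * inverse \<epsilon>"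
      using n assms(7) mult_mono[of 2 "real n" 1 "inverse \<epsilon>"] one_le_inverse[of \<epsilon>] by simp
    then have "ln 2 \<le> ln (real n * inverse \<epsilon>)" by simp
    \<comment> \<open>Together with \<open>N \<ge> 3 * s\<close> this even gives
      \<open>T \<ge> 2\<close>.\<close>
    then have ln: "2 / 3 \<le> ln (real n * inverse \<epsilon>)" using ln2_ge_two_thirds by linarith
    have "3 * real s * (2 / 3) \<le> N * ln (real n * inverse \<epsilon>)"
      by (intro mult_mono Nge ln) (use Nge in auto)
    then show ?thesis using s0 by (simp add: T_def field_simps)
  qed (simp add: T_def N_def)
  define t where "t = nat \<lfloor>T\<rfloor>"
  have t: "0 < t" "real t \<le> T" using T1 by (auto simp: t_def)
  have "mixing_time S (random_update n C E S {1..n + s * \<gamma> - 1} (block n (s * \<gamma>)))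
      (pmf_of_set S) \<epsilon> \<le> enat t"
  proof (rule mixing_time_le[OF _ t(1)])
    fix x assume x: "x \<in> S"
    obtain r where r: "0 \<le> r" "r \<le> 1 - 2 * real s / N" and
      tv: "tv_dist S (chain_distribution
          (random_update n C E S {1..n + s * \<gamma> - 1} (block n (s * \<gamma>))) t x)
        (pmf_of_set S) \<le> r ^ t * real n"
      using tv_dist_random_update[OF assms(1-6) x, of t] unfolding N_def by blast
    have "r ^ t * real n \<le> \<epsilon>"
      unfolding t_def T_def
      by (rule power_floor_le[OF r s0]) (use Nge s0 assms(5,7) T1 in \<open>auto simp: T_def\<close>)
    with tv show "tv_dist S (chain_distribution
          (random_update n C E S {1..n + s * \<gamma> - 1} (block n (s * \<gamma>))) t x)
        (pmf_of_set S) \<le> \<epsilon>" by linarith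
  qed
  then have "ereal_of_enat (mixing_time S (random_update n C E S {1..n + s * \<gamma> - 1} (block n (s * \<gamma>)))
      (pmf_of_set S) \<epsilon>) \<le> ereal_of_enat (enat t)"
    by (simp only: ereal_of_enat_le_iff)
  also have "\<dots> \<le> ereal T" using t(2) by simp
  finally show "ereal_of_enat
      (mixing_time S (random_update n C E S {1..n + s * \<gamma> - 1} (block n (s * \<gamma>))) (pmf_of_set S) \<epsilon>)
    \<le> ereal ((real n + 2 * real s * real q ^ s + real s - 1) * ln (real n * inverse \<epsilon>) / real s)"
    unfolding T_def N_def .
qed

end
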